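(* For $0<\nu<\infty$ let $\tilde X_\nu=(\tilde X_\nu(t))_{t\in\mathbb{R}}$ be a centered stationary Gaussian process with continuous sample paths and discrete spectral measure $$\tilde F_\nu=\sum_{k=-\infty}^{\infty}e^{-|k|^\nu}\,\delta_{2\pi k},$$ where $\delta_x$ is the unit point mass at $x$. Let $$\varphi(\tilde X_\nu,r)=-\log \mathbb{P}\Big(\sup_{t\in[0,1]}|\tilde X_\nu(t)|\le r\Big),\qquad r>0.$$ Then for every $\nu>0$, as $r\to0$, $$\varphi(\tilde X_\nu,r)\approx|\log r|^{1+\frac1\nu}.$$
   Context: The process is real-valued. A centered stationary Gaussian process $X$ has (symmetric, finite) spectral measure $F$ if $\mathbb{E}\,X(s)X(t)=\int_{\mathbb{R}}e^{i(s-t)u}\,F(du)$ for all $s,t\in\mathbb{R}$. For functions of $r\to 0$ (positive for small $r$), $f\preceq g$ means $\limsup_{r\to0} f(r)/g(r)<\infty$, and $f\approx g$ means that both $f\preceq g$ and $g\preceq f$ hold. *)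

theory Defs
  imports "HOL-Probability.Probability"
begin

(* Degenerate (almost surely constant) variables count as Gaussian. *)
definition gaussian_rv :: "'a measure \<Rightarrow> ('a \<Rightarrow> real) \<Rightarrow> bool" where
  "gaussian_rv M Y \<longleftrightarrow>
     Y \<in> borel_measurable M \<and>
     (\<exists>\<mu>. (AE \<omega> in M. Y \<omega> = \<mu>) \<or>
          (\<exists>\<sigma>>0. distributed M lborel Y (normal_density \<mu> \<sigma>)))"

definition gaussian_process :: "'a measure \<Rightarrow> ('t \<Rightarrow> 'a \<Rightarrow> real) \<Rightarrow> bool" where
  "gaussian_process M X \<longleftrightarrow>
     (\<forall>J c. finite J \<longrightarrow> gaussian_rv M (\<lambda>\<omega>. \<Sum>t\<in>J. c t * X t \<omega>))"

(* Integrability is stated because the expectation of a non-integrable function is 0. *)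
definition centered_process :: "'a measure \<Rightarrow> ('t \<Rightarrow> 'a \<Rightarrow> real) \<Rightarrow> bool" where
  "centered_process M X \<longleftrightarrow>
     (\<forall>t. integrable M (X t) \<and> integral\<^sup>L M (X t) = 0)"

(* Strict stationarity: shift-invariance of all finite-dimensional laws. *)
definition stationary_process :: "'a measure \<Rightarrow> (real \<Rightarrow> 'a \<Rightarrow> real) \<Rightarrow> bool" where
  "stationary_process M X \<longleftrightarrow>
     (\<forall>J h. finite J \<longrightarrow>
        distr M (\<Pi>\<^sub>M t\<in>J. borel) (\<lambda>\<omega>. \<lambda>t\<in>J. X (t + h) \<omega>) =
        distr M (\<Pi>\<^sub>M t\<in>J. borel) (\<lambda>\<omega>. \<lambda>t\<in>J. X t \<omega>))"

definition continuous_paths :: "'a measure \<Rightarrow> (real \<Rightarrow> 'a \<Rightarrow> real) \<Rightarrow> bool" where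
  "continuous_paths M X \<longleftrightarrow> (\<forall>\<omega>\<in>space M. continuous_on UNIV (\<lambda>t. X t \<omega>))"

definition has_spectral_measure ::
    "'a measure \<Rightarrow> (real \<Rightarrow> 'a \<Rightarrow> real) \<Rightarrow> real measure \<Rightarrow> bool" where
  "has_spectral_measure M X F \<longleftrightarrow>
     sets F = sets borel \<and> finite_measure F \<and> distr F borel uminus = F \<and>
     (\<forall>s t. integrable M (\<lambda>\<omega>. X s \<omega> * X t \<omega>) \<and>
            complex_of_real (\<integral>\<omega>. X s \<omega> * X t \<omega> \<partial>M) = (CLINT u|F. iexp ((s - t) * u)))"

(* The integral over count_space is the sum over all integers k. *)
definition discrete_spectral_measure :: "real \<Rightarrow> real measure" where
  "discrete_spectral_measure \<nu> =
     measure_of UNIV (sets borel)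
       (\<lambda>A. \<integral>\<^sup>+k. ennreal (exp (- (\<bar>real_of_int k\<bar> powr \<nu>))) *
                  emeasure (return borel (2 * pi * real_of_int k)) A \<partial>count_space UNIV)"

lemma sets_discrete_spectral_measure [simp]:
  "sets (discrete_spectral_measure \<nu>) = sets borel"
  unfolding discrete_spectral_measure_def using sets.sets_measure_of_eq[of "borel :: real measure"] by simp

lemma space_discrete_spectral_measure [simp]:
  "space (discrete_spectral_measure \<nu>) = UNIV"
  using sets_eq_imp_space_eq[OF sets_discrete_spectral_measure[of \<nu>]] by simp

(* The set function above is countably additive, so measure_of does not
   collapse to the null measure. *)
lemma emeasure_discrete_spectral_measure:
  assumes "A \<in> sets borel"
  shows "emeasure (discrete_spectral_measure \<nu>) A =
    (\<integral>\<^sup>+k. ennreal (exp (- (\<bar>real_of_int k\<bar> powr \<nu>))) *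
          emeasure (return borel (2 * pi * real_of_int k)) A \<partial>count_space UNIV)"
proof (rule emeasure_measure_of[OF discrete_spectral_measure_def])
  show "sets borel \<subseteq> Pow (UNIV :: real set)"
    by simp
  show "A \<in> sets (discrete_spectral_measure \<nu>)"
    using assms by simp
  show "positive (sets (discrete_spectral_measure \<nu>))
     (\<lambda>A. \<integral>\<^sup>+k. ennreal (exp (- (\<bar>real_of_int k\<bar> powr \<nu>))) *
          emeasure (return borel (2 * pi * real_of_int k)) A \<partial>count_space UNIV)"
    by (simp add: positive_def)
  show "countably_additive (sets (discrete_spectral_measure \<nu>))
     (\<lambda>A. \<integral>\<^sup>+k. ennreal (exp (- (\<bar>real_of_int k\<bar> powr \<nu>))) *
          emeasure (return borel (2 * pi * real_of_int k)) A \<partial>count_space UNIV)"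
  proof (rule countably_additiveI)
    fix B :: "nat \<Rightarrow> real set"
    assume B: "range B \<subseteq> sets (discrete_spectral_measure \<nu>)" "disjoint_family B"
    have "(\<Sum>i. emeasure (return borel x) (B i)) = emeasure (return borel x) (\<Union>i. B i)"
      for x :: real
      using B by (intro suminf_emeasure) auto
    then show "(\<Sum>i. \<integral>\<^sup>+k. ennreal (exp (- (\<bar>real_of_int k\<bar> powr \<nu>))) *
          emeasure (return borel (2 * pi * real_of_int k)) (B i) \<partial>count_space UNIV) =
        (\<integral>\<^sup>+k. ennreal (exp (- (\<bar>real_of_int k\<bar> powr \<nu>))) *
          emeasure (return borel (2 * pi * real_of_int k)) (\<Union>i. B i) \<partial>count_space UNIV)"
      by (subst nn_integral_suminf[symmetric]) (simp_all only: borel_measurable_count_space ennreal_suminf_cmult)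
  qed
qed

definition small_deviation :: "'a measure \<Rightarrow> (real \<Rightarrow> 'a \<Rightarrow> real) \<Rightarrow> real \<Rightarrow> real" where
  "small_deviation M X r =
     - ln (measure M {\<omega> \<in> space M. (SUP t\<in>{0..1}. \<bar>X t \<omega>\<bar>) \<le> r})"

(* Both relations are only meant for functions that are positive near 0.  Making this
   part of the definition excludes the artefacts ln 0 = 0 and x / 0 = 0. *)
definition asymp_le :: "(real \<Rightarrow> real) \<Rightarrow> (real \<Rightarrow> real) \<Rightarrow> bool" (infix "\<preceq>\<^sub>0" 50) where
  "f \<preceq>\<^sub>0 g \<longleftrightarrow>
     (\<forall>\<^sub>F r in at_right 0. 0 < f r) \<and> (\<forall>\<^sub>F r in at_right 0. 0 < g r) \<and>
     Limsup (at_right 0) (\<lambda>r. ereal (f r / g r)) < \<infinity>"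

definition asymp_eq :: "(real \<Rightarrow> real) \<Rightarrow> (real \<Rightarrow> real) \<Rightarrow> bool" (infix "\<approx>\<^sub>0" 50) where
  "f \<approx>\<^sub>0 g \<longleftrightarrow> f \<preceq>\<^sub>0 g \<and> g \<preceq>\<^sub>0 f"

end

(* The Hartley coefficients Z k of the process on a grid of N equidistant points of [0,1) are
   uncorrelated Gaussian variables, hence independent; aliasing makes the variance of Z k the spectral
   mass of the frequencies congruent to k modulo N.  If the supremum is at most r, then the n + 1
   coefficients with k^nu <= |log r|, where n is about |log r|^(1/nu), are at most 2r although their
   standard deviations are at least sqrt r, which happens with probability at most (2 sqrt r)^(n+1).
   Conversely, small coefficients force a small supremum on the grid, with bounds that do not depend
   on N; refining the grid and using continuity of the paths gives the bound for the supremum. *)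

theory Submission
  imports Defs "HOL-Real_Asymp.Real_Asymp"
begin

section \<open>Independence of uncorrelated Gaussian variables\<close>

text \<open>The order |log r|^(1+1/nu) is a number of frequencies, about |log r|^(1/nu), times the
  cost |log r| of a factor that is a power of r for each of them; both bounds count these
  frequencies. On a grid every coefficient is a finite linear combination of values of the process,
  so Gaussianity and covariances come straight from the hypotheses, without expanding the process in
  a series. The price is aliasing. It is harmless: from below, aliases only add to a variance; from
  above, no alias is closer to 0 than the representative of least modulus, and giving up half of the
  exponent pays for the sum over all aliases, uniformly in N. The transform enters the two
  directions differently. A small supremum bounds each coefficient by averaging, and one grid
  suffices, with as many points as coefficients are used. In the converse the coefficients are
  summed, so r is divided among the frequencies in summable shares, and since all coefficients of
  ever finer grids take part, the probabilities of high frequencies must tend to 1 fast enough for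
  their product to stay away from 0.\<close>

text \<open>Normalise \<open>W\<close> to a probability density, unless it vanishes almost
  everywhere. The hypothesis says that \<open>Y\<close> has the same characteristic function under
  the reweighted measure as under \<open>M\<close>, hence the same law by Levy's uniqueness
  theorem.\<close>

lemma nonneg_weight_char_factor:
  fixes W Y :: "'a \<Rightarrow> real"
  assumes "prob_space M"
    and [measurable]: "W \<in> borel_measurable M" "Y \<in> borel_measurable M" "A \<in> sets borel"
    and W: "\<And>x. 0 \<le> W x" "integrable M W"
    and char: "\<And>t. (CLINT x|M. W x * iexp (t * Y x)) = (LINT x|M. W x) * (CLINT x|M. iexp (t * Y x))"
  shows "(LINT x|M. W x * indicator A (Y x)) = (LINT x|M. W x) * measure M {x \<in> space M. Y x \<in> A}"
proof (cases "(LINT x|M. W x) = 0")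
  case True
  then have "AE x in M. W x = 0"
    using W by (subst (asm) integral_nonneg_eq_0_iff_AE) auto
  then have "(LINT x|M. W x * indicator A (Y x)) = (LINT x|M. 0)"
    by (intro integral_cong_AE) auto
  then show ?thesis
    using True by simp
next
  case False
  interpret prob_space M by fact
  define c where "c = (LINT x|M. W x)"
  have c: "c > 0"
    using False integral_nonneg_AE[of W M] W unfolding c_def by (auto simp: less_le)
  define Q where "Q = density M (\<lambda>x. W x / c)"
  have "emeasure Q (space Q) = (\<integral>\<^sup>+x. W x / c \<partial>M)"
    unfolding Q_def by (subst emeasure_density) (auto intro!: nn_integral_cong)
  also have "\<dots> = ennreal (LINT x|M. W x / c)"
    using W c by (intro nn_integral_eq_integral) auto
  also have "\<dots> = 1"
    using c by (simp add: c_def)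
  finally interpret Q: prob_space Q
    by (rule prob_spaceI)
  have [measurable]: "Y \<in> borel_measurable Q"
    unfolding Q_def by simp
  have "char (distr Q borel Y) = char (distr M borel Y)"
  proof
    fix t
    have "char (distr Q borel Y) t = (CLINT x|Q. iexp (t * Y x))"
      unfolding char_def by (subst integral_distr) auto
    also have "\<dots> = (CLINT x|M. (W x / c) *\<^sub>R iexp (t * Y x))"
      unfolding Q_def using W c by (subst integral_density) auto
    also have "\<dots> = (CLINT x|M. W x * iexp (t * Y x)) / c"
      by (subst integral_divide_zero[symmetric]) (auto simp: scaleR_conv_of_real)
    also have "\<dots> = (CLINT x|M. iexp (t * Y x))"
      using c unfolding char c_def[symmetric] by simp
    also have "\<dots> = char (distr M borel Y) t"
      unfolding char_def by (subst integral_distr) auto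
    finally show "char (distr Q borel Y) t = char (distr M borel Y) t" .
  qed
  then have "distr Q borel Y = distr M borel Y"
    by (intro Levy_uniqueness Q.real_distribution_distr real_distribution_distr) auto
  then have eq: "measure (distr Q borel Y) A = measure (distr M borel Y) A"
    by simp
  have "(LINT x|M. W x * indicator A (Y x)) = c * (LINT x|M. (W x / c) *\<^sub>R (indicator A (Y x) :: real))"
    using c by (subst integral_mult_right_zero[symmetric]) auto
  also have "(LINT x|M. (W x / c) *\<^sub>R (indicator A (Y x) :: real)) = (LINT x|Q. indicator A (Y x))"
    unfolding Q_def using W c by (subst integral_density) auto
  also have "\<dots> = (LINT y|distr Q borel Y. indicator A y)"
    by (subst integral_distr) auto
  also have "\<dots> = measure (distr Q borel Y) A"
    by simp
  also have "\<dots> = measure M {x \<in> space M. Y x \<in> A}"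
    unfolding eq by (subst measure_distr) (auto intro!: arg_cong[where f="measure M"])
  finally show ?thesis
    by (simp add: c_def)
qed

text \<open>Reduction to nonnegative weights: split \<open>W\<close> into real and imaginary part,
  and add a constant to each.\<close>

lemma bounded_weight_char_factor:
  fixes W :: "'a \<Rightarrow> complex" and Y :: "'a \<Rightarrow> real"
  assumes "prob_space M"
    and [measurable]: "W \<in> borel_measurable M" "Y \<in> borel_measurable M" "A \<in> sets borel"
    and bound: "\<And>x. norm (W x) \<le> C"
    and char: "\<And>t. (CLINT x|M. W x * iexp (t * Y x)) = (CLINT x|M. W x) * (CLINT x|M. iexp (t * Y x))"
  shows "(CLINT x|M. W x * indicator A (Y x)) = (CLINT x|M. W x) * measure M {x \<in> space M. Y x \<in> A}"
proof -
  interpret prob_space M by fact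
  have int_W: "integrable M W"
    by (rule integrable_const_bound[where B=C]) (use bound in auto)
  have int_iexp: "integrable M (\<lambda>x. iexp (t * Y x))" for t
    by (rule integrable_const_bound[where B=1]) auto
  have int_Wiexp: "integrable M (\<lambda>x. W x * iexp (t * Y x))" for t
    by (rule integrable_const_bound[where B=C]) (use bound in \<open>auto simp: norm_mult\<close>)
  have [measurable]: "(\<lambda>x. cnj (W x)) \<in> borel_measurable M"
    by (rule borel_measurable_continuous_on[OF _ assms(2)]) (intro continuous_intros)
  have int_cW: "integrable M (\<lambda>x. cnj (W x))"
    by (rule integrable_const_bound[where B=C]) (use bound in auto)
  have int_cWiexp: "integrable M (\<lambda>x. cnj (W x) * iexp (t * Y x))" for t
    by (rule integrable_const_bound[where B=C]) (use bound in \<open>auto simp: norm_mult\<close>)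
  \<comment> \<open>Conjugation turns the frequency \<open>t\<close> into \<open>- t\<close>; as the
    hypothesis holds at every frequency, \<open>cnj W\<close> inherits it, and so do the real
    combinations of \<open>W\<close> and \<open>cnj W\<close>.\<close>
  have char_cnj: "(CLINT x|M. cnj (W x) * iexp (t * Y x)) = (CLINT x|M. cnj (W x)) * (CLINT x|M. iexp (t * Y x))" for t
  proof -
    have "(CLINT x|M. cnj (W x) * iexp (t * Y x)) = (CLINT x|M. cnj (W x * iexp ((- t) * Y x)))"
      by (simp add: exp_cnj)
    also have "\<dots> = cnj ((CLINT x|M. W x) * (CLINT x|M. iexp ((- t) * Y x)))"
      unfolding char[of "- t", symmetric] by (rule Bochner_Integration.integral_cnj)
    also have "\<dots> = (CLINT x|M. cnj (W x)) * (CLINT x|M. cnj (iexp ((- t) * Y x)))"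
      by (simp only: complex_cnj_mult Bochner_Integration.integral_cnj)
    finally show ?thesis
      by (simp add: exp_cnj)
  qed
  \<comment> \<open>\<open>a = 1\<close> gives the real part of \<open>W\<close>,
    \<open>a = - \<i>\<close> the imaginary part.\<close>
  have real: "(LINT x|M. V x * indicator A (Y x)) = (LINT x|M. V x) * prob {x \<in> space M. Y x \<in> A}"
    if V: "V = (\<lambda>x. Re (a * W x))" for V a
  proof -
    have [measurable]: "V \<in> borel_measurable M"
      unfolding V by measurable
    have bV: "\<bar>V x\<bar> \<le> norm a * C" for x
      using abs_Re_le_cmod[of "a * W x"] bound[of x] unfolding V
      by (auto simp: norm_mult intro: order_trans[OF _ mult_left_mono])
    have int_V: "integrable M V"
      by (rule integrable_const_bound[where B="norm a * C"]) (use bV in auto)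
    have int_VA: "integrable M (\<lambda>x. V x * indicator A (Y x))"
      by (rule integrable_const_bound[where B="norm a * C"])
         (use bV in \<open>auto simp: indicator_def intro: order_trans[OF abs_ge_zero]\<close>)
    have V_eq: "complex_of_real (V x) = (a * W x + cnj a * cnj (W x)) / 2" for x
      unfolding V by (simp add: complex_eq_iff)
    have charV: "(CLINT x|M. V x * iexp (t * Y x)) = (LINT x|M. V x) * (CLINT x|M. iexp (t * Y x))" for t
    proof -
      have "(CLINT x|M. V x * iexp (t * Y x)) =
          (CLINT x|M. (a / 2) * (W x * iexp (t * Y x)) + (cnj a / 2) * (cnj (W x) * iexp (t * Y x)))"
        by (intro Bochner_Integration.integral_cong) (auto simp: V_eq field_simps)
      also have "\<dots> = (a / 2) * (CLINT x|M. W x * iexp (t * Y x)) + (cnj a / 2) * (CLINT x|M. cnj (W x) * iexp (t * Y x))"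
        using int_Wiexp int_cWiexp by (subst Bochner_Integration.integral_add) auto
      also have "\<dots> = ((a / 2) * (CLINT x|M. W x) + (cnj a / 2) * (CLINT x|M. cnj (W x))) * (CLINT x|M. iexp (t * Y x))"
        by (simp only: char char_cnj) (simp add: algebra_simps)
      also have "(a / 2) * (CLINT x|M. W x) + (cnj a / 2) * (CLINT x|M. cnj (W x)) =
          (CLINT x|M. (a / 2) * W x + (cnj a / 2) * cnj (W x))"
        using int_W int_cW by (subst Bochner_Integration.integral_add) auto
      also have "\<dots> = (CLINT x|M. complex_of_real (V x))"
        by (intro Bochner_Integration.integral_cong) (auto simp: V_eq field_simps)
      finally show ?thesis
        by simp
    qed
    let ?K = "norm a * C"
    \<comment> \<open>The shift by the bound \<open>?K\<close> makes the weight nonnegative.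
      Constants satisfy the claim trivially, so the shift can be subtracted again.\<close>
    have "(LINT x|M. (V x + ?K) * indicator A (Y x)) = (LINT x|M. V x + ?K) * prob {x \<in> space M. Y x \<in> A}"
    proof (rule nonneg_weight_char_factor)
      show "0 \<le> V x + ?K" for x
        using bV[of x] by linarith
      have int_Viexp: "integrable M (\<lambda>x. V x * iexp (t * Y x))" for t
        by (rule integrable_const_bound[where B="?K"]) (use bV in \<open>auto simp: norm_mult\<close>)
      show "(CLINT x|M. complex_of_real (V x + ?K) * iexp (t * Y x)) =
          complex_of_real (LINT x|M. V x + ?K) * (CLINT x|M. iexp (t * Y x))" for t
        using int_V int_Viexp[of t] int_iexp[of t]
        using charV[of t] by (simp add: distrib_right prob_space)
    qed (use int_V in \<open>auto intro: prob_space_axioms\<close>)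
    moreover have "(LINT x|M. (V x + ?K) * indicator A (Y x)) =
        (LINT x|M. V x * indicator A (Y x)) + ?K * (LINT x|M. indicator A (Y x))"
      using int_VA
      by (subst integral_mult_right_zero[symmetric], subst Bochner_Integration.integral_add[symmetric])
         (auto simp: distrib_right intro!: integrable_mult_right integrable_const_bound[where B=1])
    moreover have "(LINT x|M. indicator A (Y x)) = prob {x \<in> space M. Y x \<in> A}"
    proof -
      have "(LINT x|M. indicator A (Y x)) = (LINT x|M. (indicator {x \<in> space M. Y x \<in> A} x :: real))"
        by (intro Bochner_Integration.integral_cong) (auto simp: indicator_def)
      then show ?thesis
        by simp
    qed
    ultimately show ?thesis
      using int_V by (simp add: prob_space algebra_simps)
  qed
  have int_WA: "integrable M (\<lambda>x. W x * indicator A (Y x))"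
    by (rule integrable_const_bound[where B=C])
       (use bound in \<open>auto simp: indicator_def intro: order_trans[OF norm_ge_zero]\<close>)
  show ?thesis
  proof (rule complex_eqI)
    have "Re (CLINT x|M. W x * indicator A (Y x)) = (LINT x|M. Re (1 * W x) * indicator A (Y x))"
      by (subst integral_Re[OF int_WA, symmetric])
         (auto intro!: Bochner_Integration.integral_cong split: split_indicator)
    also have "\<dots> = Re (CLINT x|M. W x) * prob {x \<in> space M. Y x \<in> A}"
      by (subst real[OF refl]) (use integral_Re[OF int_W] in simp)
    finally show "Re (CLINT x|M. W x * indicator A (Y x)) = Re ((CLINT x|M. W x) * prob {x \<in> space M. Y x \<in> A})"
      by simp
    have "Im (CLINT x|M. W x * indicator A (Y x)) = (LINT x|M. Re (- \<i> * W x) * indicator A (Y x))"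
      by (subst integral_Im[OF int_WA, symmetric])
         (auto intro!: Bochner_Integration.integral_cong split: split_indicator)
    also have "\<dots> = Im (CLINT x|M. W x) * prob {x \<in> space M. Y x \<in> A}"
      by (subst real[OF refl]) (use integral_Im[OF int_W] in simp)
    finally show "Im (CLINT x|M. W x * indicator A (Y x)) = Im ((CLINT x|M. W x) * prob {x \<in> space M. Y x \<in> A})"
      by simp
  qed
qed

text \<open>Kac's theorem, proved by replacing the factors \<open>exp (i t Y)\<close> by indicators one at a time.\<close>

lemma prob_Ball_eq_prod_if_char_factor:
  fixes Y :: "'i \<Rightarrow> 'a \<Rightarrow> real"
  assumes "prob_space M" and I: "finite I"
    and Y [measurable]: "\<And>i. i \<in> I \<Longrightarrow> Y i \<in> borel_measurable M"
    and A [measurable]: "\<And>i. i \<in> I \<Longrightarrow> A i \<in> sets borel"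
    and char: "\<And>t. (CLINT x|M. iexp (\<Sum>i\<in>I. t i * Y i x)) = (\<Prod>i\<in>I. CLINT x|M. iexp (t i * Y i x))"
  shows "measure M {x \<in> space M. \<forall>i\<in>I. Y i x \<in> A i} = (\<Prod>i\<in>I. measure M {x \<in> space M. Y i x \<in> A i})"
proof -
  interpret prob_space M by fact
  \<comment> \<open>\<open>J\<close> collects the indices already converted to indicators. The
    frequencies \<open>t\<close> stay arbitrary, because converting the next index uses the identity
    at all of its frequencies.\<close>
  have "(CLINT x|M. (\<Prod>i\<in>J. indicator (A i) (Y i x)) * iexp (\<Sum>i\<in>I - J. t i * Y i x)) =
      (\<Prod>i\<in>J. complex_of_real (prob {x \<in> space M. Y i x \<in> A i})) * (\<Prod>i\<in>I - J. CLINT x|M. iexp (t i * Y i x))"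
    if "J \<subseteq> I" for J t
    using finite_subset[OF that I] that
  proof (induction J arbitrary: t rule: finite_induct)
    case empty
    then show ?case
      using char[of t] by simp
  next
    case (insert j J)
    have [simp]: "finite (I - J)" "finite (I - insert j J)"
      using I by auto
    have IJ: "I - J = insert j (I - insert j J)" and j: "j \<in> I" and J: "J \<subseteq> I"
      using insert by auto
    have [measurable]: "Y j \<in> borel_measurable M" "A j \<in> sets borel"
      using j by auto
    let ?W = "\<lambda>x. (\<Prod>i\<in>J. indicator (A i) (Y i x)) * iexp (\<Sum>i\<in>I - insert j J. t i * Y i x)"
    let ?P = "\<Prod>i\<in>J. complex_of_real (prob {x \<in> space M. Y i x \<in> A i})"
    let ?Q = "\<Prod>i\<in>I - insert j J. CLINT x|M. iexp (t i * Y i x)"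
    \<comment> \<open>The induction hypothesis at \<open>t(j := s)\<close>: with the other
      frequencies fixed, the integral is, as a function of \<open>s\<close>, a multiple of the
      characteristic function of \<open>Y j\<close>.\<close>
    have W: "(CLINT x|M. ?W x * iexp (s * Y j x)) = (?P * ?Q) * (CLINT x|M. iexp (s * Y j x))" for s
    proof -
      have "(\<Sum>i\<in>I - insert j J. (t(j := s)) i * Y i x) = (\<Sum>i\<in>I - insert j J. t i * Y i x)" for x
        by (intro sum.cong) auto
      then have "?W x * iexp (s * Y j x) =
          (\<Prod>i\<in>J. indicator (A i) (Y i x)) * iexp (\<Sum>i\<in>I - J. (t(j := s)) i * Y i x)" for x
        unfolding IJ by (simp add: exp_add[symmetric] algebra_simps)
      then have "(CLINT x|M. ?W x * iexp (s * Y j x)) =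
          (CLINT x|M. (\<Prod>i\<in>J. indicator (A i) (Y i x)) * iexp (\<Sum>i\<in>I - J. (t(j := s)) i * Y i x))"
        by (simp only:)
      also have "\<dots> = ?P * (\<Prod>i\<in>I - J. CLINT x|M. iexp ((t(j := s)) i * Y i x))"
        by (rule insert.IH[OF J])
      also have "(\<Prod>i\<in>I - J. CLINT x|M. iexp ((t(j := s)) i * Y i x)) = (CLINT x|M. iexp (s * Y j x)) * ?Q"
        unfolding IJ by (subst prod.insert) (auto intro!: prod.cong)
      finally show ?thesis
        by (simp add: mult_ac)
    qed
    \<comment> \<open>Frequency 0 identifies the constant multiple as the integral of the
      weight.\<close>
    from W[of 0] have W0: "(CLINT x|M. ?W x) = ?P * ?Q"
      by (simp add: prob_space)
    have "(CLINT x|M. ?W x * indicator (A j) (Y j x)) = (CLINT x|M. ?W x) * prob {x \<in> space M. Y j x \<in> A j}"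
    proof (rule bounded_weight_char_factor)
      show "?W \<in> borel_measurable M"
        using J by (intro borel_measurable_times borel_measurable_prod) (auto intro!: borel_measurable_sum measurable_compose[OF Y] )
      show "norm (?W x) \<le> 1" for x
        by (auto simp: norm_mult prod_norm[symmetric] intro!: prod_le_1 split: split_indicator)
      show "(CLINT x|M. ?W x * iexp (s * Y j x)) = (CLINT x|M. ?W x) * (CLINT x|M. iexp (s * Y j x))" for s
        by (simp only: W W0)
    qed (auto intro: prob_space_axioms)
    then show ?case
      using insert.hyps unfolding W0 by (simp add: mult_ac)
  qed
  from this[of I] have "(CLINT x|M. (\<Prod>i\<in>I. indicator (A i) (Y i x))) =
      (\<Prod>i\<in>I. complex_of_real (prob {x \<in> space M. Y i x \<in> A i}))"
    by simp
  moreover have "(\<Prod>i\<in>I. indicator (A i) (Y i x)) =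
      complex_of_real (indicator {x \<in> space M. \<forall>i\<in>I. Y i x \<in> A i} x)" if "x \<in> space M" for x
    using I that by (auto simp: indicator_def prod_zero_iff)
  then have "(CLINT x|M. (\<Prod>i\<in>I. indicator (A i) (Y i x))) =
      (CLINT x|M. complex_of_real (indicator {x \<in> space M. \<forall>i\<in>I. Y i x \<in> A i} x))"
    by (intro Bochner_Integration.integral_cong) auto
  moreover have "\<dots> = complex_of_real (prob {x \<in> space M. \<forall>i\<in>I. Y i x \<in> A i})"
    by (subst integral_complex_of_real) (simp add: I)
  ultimately show ?thesis
    by (simp only: of_real_prod[symmetric] of_real_eq_iff)
qed

section \<open>Centered Gaussian variables: characteristic function and probabilities of
  intervals\<close>

lemma gaussian_rv_centered_cases:
  assumes "prob_space M" "gaussian_rv M Y" and mean: "integral\<^sup>L M Y = 0"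
  obtains "AE x in M. Y x = 0" "(LINT x|M. (Y x)\<^sup>2) = 0"
    | \<sigma> where "\<sigma> > 0" "distributed M lborel Y (normal_density 0 \<sigma>)" "(LINT x|M. (Y x)\<^sup>2) = \<sigma>\<^sup>2"
proof -
  interpret prob_space M by fact
  have [measurable]: "Y \<in> borel_measurable M"
    using assms(2) by (simp add: gaussian_rv_def)
  from assms(2) obtain \<mu> where "(AE x in M. Y x = \<mu>) \<or> (\<exists>\<sigma>>0. distributed M lborel Y (normal_density \<mu> \<sigma>))"
    by (auto simp: gaussian_rv_def)
  then consider "AE x in M. Y x = \<mu>" | \<sigma> where "\<sigma> > 0" "distributed M lborel Y (normal_density \<mu> \<sigma>)"
    by blast
  then show thesis
  proof cases
    case 1
    then have "integral\<^sup>L M Y = (LINT x|M. \<mu>)"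
      by (intro integral_cong_AE) auto
    with mean have [simp]: "\<mu> = 0"
      by (simp add: prob_space)
    have "(LINT x|M. (Y x)\<^sup>2) = (LINT x|M. 0)"
      using 1 by (intro integral_cong_AE) auto
    with 1 that(1) show thesis
      by simp
  next
    case 2
    have [simp]: "\<mu> = 0"
      using normal_distributed_expectation[OF 2] mean by simp
    show thesis
      using normal_distributed_variance[OF 2] 2 mean that(2) by simp
  qed
qed

lemma gaussian_rv_iexp:
  assumes "prob_space M" "gaussian_rv M Y" "integral\<^sup>L M Y = 0"
  shows "(CLINT x|M. iexp (Y x)) = exp (- (LINT x|M. (Y x)\<^sup>2) / 2)"
  using assms
proof (cases rule: gaussian_rv_centered_cases)
  case 1
  interpret prob_space M by fact
  have [measurable]: "Y \<in> borel_measurable M"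
    using assms(2) by (simp add: gaussian_rv_def)
  have "(CLINT x|M. iexp (Y x)) = (CLINT x|M. 1)"
    using 1(1) by (intro integral_cong_AE) auto
  with 1(2) show ?thesis
    by (simp add: prob_space)
next
  case (2 \<sigma>)
  interpret prob_space M by fact
  have D: "distributed M lborel (\<lambda>x. Y x / \<sigma>) std_normal_density"
    using normal_standard_normal_convert[OF 2(1), of Y 0] 2(2) by simp
  have [measurable]: "Y \<in> borel_measurable M"
    using assms(2) by (simp add: gaussian_rv_def)
  have "(CLINT x|M. iexp (Y x)) = (CLINT x|M. iexp (\<sigma> * (Y x / \<sigma>)))"
    using 2(1) by simp
  also have "\<dots> = char (distr M lborel (\<lambda>x. Y x / \<sigma>)) \<sigma>"
    unfolding char_def by (subst integral_distr) auto
  also have "distr M lborel (\<lambda>x. Y x / \<sigma>) = std_normal_distribution"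
    by (rule distributed_distr_eq_density[OF D])
  finally show ?thesis
    by (simp only: char_std_normal_distribution 2(3))
qed

text \<open>The density is at most \<open>1 / (2 * \<sigma>)\<close>, since
  \<open>sqrt (2 * pi)\<close> is at least 2, and the interval has length \<open>2 * a\<close>.
  Positivity of \<open>s\<close> rules out the degenerate case.\<close>

lemma gaussian_rv_prob_le:
  assumes "prob_space M" "gaussian_rv M Y" "integral\<^sup>L M Y = 0"
    and s: "0 < s" "s\<^sup>2 \<le> (LINT x|M. (Y x)\<^sup>2)" and a: "0 \<le> a"
  shows "measure M {x \<in> space M. Y x \<in> {- a..a}} \<le> a / s"
  using assms(1-3)
proof (cases rule: gaussian_rv_centered_cases)
  case 1
  then show ?thesis
    using s by (simp add: power2_le_iff_abs_le)
next
  case (2 \<sigma>)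
  interpret prob_space M by fact
  have s\<sigma>: "s \<le> \<sigma>"
    using s 2 by (simp add: power2_le_iff_abs_le)
  have "4 \<le> 2 * pi"
    using pi_gt3 by simp
  then have "2 \<le> sqrt (2 * pi)"
    by (metis real_sqrt_le_iff real_sqrt_four)
  have le: "normal_density 0 \<sigma> y \<le> 1 / (2 * \<sigma>)" for y
  proof -
    have "normal_density 0 \<sigma> y \<le> 1 / sqrt (2 * pi * \<sigma>\<^sup>2)"
      unfolding normal_density_def by (rule mult_right_le_one_le) auto
    also have "\<dots> \<le> 1 / (2 * \<sigma>)"
      using 2(1) \<open>2 \<le> sqrt (2 * pi)\<close> by (auto simp: real_sqrt_mult intro!: divide_left_mono mult_right_mono)
    finally show ?thesis .
  qed
  have "emeasure M {x \<in> space M. Y x \<in> {- a..a}} = emeasure M (Y -` {- a..a} \<inter> space M)"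
    by (intro arg_cong[where f="emeasure M"]) auto
  also have "\<dots> = (\<integral>\<^sup>+y. ennreal (normal_density 0 \<sigma> y) * indicator {- a..a} y \<partial>lborel)"
    by (rule distributed_emeasure[OF 2(2)]) simp
  also have "\<dots> \<le> (\<integral>\<^sup>+y. ennreal (1 / (2 * \<sigma>)) * indicator {- a..a} y \<partial>lborel)"
    by (intro nn_integral_mono mult_right_mono ennreal_leI le) auto
  also have "\<dots> = ennreal (1 / (2 * \<sigma>)) * ennreal (2 * a)"
    using a by (subst nn_integral_cmult_indicator) auto
  also have "\<dots> = ennreal (a / \<sigma>)"
    using a 2(1) by (subst ennreal_mult[symmetric]) auto
  also have "\<dots> \<le> ennreal (a / s)"
    using a s(1) s\<sigma> by (intro ennreal_leI divide_left_mono) auto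
  finally show ?thesis
    using a s(1) by (simp add: emeasure_eq_measure)
qed

text \<open>Two regimes. \<open>?small\<close> has the right order when \<open>a\<close> is below
  \<open>s\<close>, but never exceeds 1/4, which is useless in long products; \<open>?large\<close>,
  which is Chebyshev's inequality, tends to 1 as \<open>s / a\<close> tends to 0.\<close>

lemma gaussian_rv_prob_ge:
  assumes "prob_space M" "gaussian_rv M Y" "integral\<^sup>L M Y = 0"
    and s: "0 < s" "(LINT x|M. (Y x)\<^sup>2) \<le> s\<^sup>2" and a: "0 < a"
  shows "min 1 (a / s) / 4 \<le> measure M {x \<in> space M. Y x \<in> {- a..a}}" (is ?small)
    and "1 - s\<^sup>2 / a\<^sup>2 \<le> measure M {x \<in> space M. Y x \<in> {- a..a}}" (is ?large)
proof -
  interpret prob_space M by fact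
  have [measurable]: "Y \<in> borel_measurable M"
    using assms(2) by (simp add: gaussian_rv_def)
  have "?small \<and> ?large"
    using assms(1-3)
  proof (cases rule: gaussian_rv_centered_cases)
    case 1
    then have "prob {x \<in> space M. Y x \<in> {- a..a}} = 1"
      using a by (intro prob_Collect_eq_1[THEN iffD2]) auto
    then show ?thesis
      using a s(1) by auto
  next
    case (2 \<sigma>)
    have s\<sigma>: "\<sigma> \<le> s"
      using s 2 by (simp add: power2_le_iff_abs_le)
    have "2 * pi \<le> 16"
      using pi_less_4 by simp
    then have "sqrt (2 * pi) \<le> sqrt (4\<^sup>2)"
      by (subst real_sqrt_le_iff) simp
    then have "sqrt (2 * pi) \<le> 4"
      by simp
    \<comment> \<open>Within one standard deviation of 0 the density is at least
      \<open>1 / (8 * \<sigma>)\<close>: the exponential is at least 1/2 and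
      \<open>sqrt (2 * pi)\<close> is at most 4.\<close>
    define b where "b = min a \<sigma>"
    have b: "0 < b" "b \<le> a" "b \<le> \<sigma>"
      using a 2(1) by (auto simp: b_def)
    have ge: "1 / (8 * \<sigma>) \<le> normal_density 0 \<sigma> y" if "y \<in> {- b..b}" for y
    proof -
      have "y\<^sup>2 \<le> \<sigma>\<^sup>2"
        using that b by (intro abs_le_square_iff[THEN iffD1]) auto
      then have "y\<^sup>2 / (2 * \<sigma>\<^sup>2) \<le> 1 / 2"
        using 2(1) by (simp add: field_simps)
      then have *: "1 / 2 \<le> exp (- (y\<^sup>2 / (2 * \<sigma>\<^sup>2)))"
        using exp_ge_add_one_self[of "- (y\<^sup>2 / (2 * \<sigma>\<^sup>2))"] by linarith
      have "1 / (8 * \<sigma>) = 1 / (4 * \<sigma>) * (1 / 2)"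
        by simp
      also have "\<dots> \<le> 1 / (sqrt (2 * pi) * \<sigma>) * exp (- (y\<^sup>2 / (2 * \<sigma>\<^sup>2)))"
        using 2(1) \<open>sqrt (2 * pi) \<le> 4\<close> * by (intro mult_mono divide_left_mono mult_right_mono) auto
      finally show ?thesis
        using 2(1) by (simp add: normal_density_def real_sqrt_mult)
    qed
    have "ennreal (b / (4 * \<sigma>)) = ennreal (1 / (8 * \<sigma>)) * ennreal (2 * b)"
      using b 2(1) by (subst ennreal_mult[symmetric]) auto
    also have "\<dots> = (\<integral>\<^sup>+y. ennreal (1 / (8 * \<sigma>)) * indicator {- b..b} y \<partial>lborel)"
      using b by (subst nn_integral_cmult_indicator) auto
    also have "\<dots> \<le> (\<integral>\<^sup>+y. ennreal (normal_density 0 \<sigma> y) * indicator {- a..a} y \<partial>lborel)"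
      using ge b by (intro nn_integral_mono) (auto simp: indicator_def intro!: ennreal_leI)
    also have "\<dots> = emeasure M (Y -` {- a..a} \<inter> space M)"
      by (rule distributed_emeasure[OF 2(2), symmetric]) simp
    also have "\<dots> = emeasure M {x \<in> space M. Y x \<in> {- a..a}}"
      by (intro arg_cong[where f="emeasure M"]) auto
    finally have "b / (4 * \<sigma>) \<le> prob {x \<in> space M. Y x \<in> {- a..a}}"
      by (simp add: emeasure_eq_measure)
    moreover have "min 1 (a / s) / 4 \<le> b / (4 * \<sigma>)"
    proof -
      have "a / s \<le> a / \<sigma>"
        using a 2(1) s\<sigma> by (intro divide_left_mono) auto
      then have "min 1 (a / s) / 4 \<le> min 1 (a / \<sigma>) / 4"
        by auto
      also have "\<dots> = b / (4 * \<sigma>)"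
        using 2(1) by (simp add: b_def min_def field_simps split: if_splits)
      finally show ?thesis .
    qed
    moreover have ?large
    proof -
      \<comment> \<open>The integral of a non-integrable function is 0, while this one is the
        positive \<open>\<sigma>\<^sup>2\<close>.\<close>
      have "integrable M (\<lambda>x. (Y x)\<^sup>2)"
        using 2(1,3) not_integrable_integral_eq[of M "\<lambda>x. (Y x)\<^sup>2"] by auto
      then have "prob {x \<in> space M. \<bar>Y x\<bar> \<ge> a} \<le> \<sigma>\<^sup>2 / a\<^sup>2"
        using Chebyshev_inequality[of Y a] a assms(3) 2(3) by simp
      also have "\<dots> \<le> s\<^sup>2 / a\<^sup>2"
        using s 2(3) by (intro divide_right_mono) auto
      finally have "prob {x \<in> space M. \<bar>Y x\<bar> \<ge> a} \<le> s\<^sup>2 / a\<^sup>2" .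
      moreover have "1 - prob {x \<in> space M. Y x \<in> {- a..a}} = prob {x \<in> space M. \<not> Y x \<in> {- a..a}}"
        by (subst prob_neg) auto
      moreover have "\<dots> \<le> prob {x \<in> space M. \<bar>Y x\<bar> \<ge> a}"
        by (intro finite_measure_mono) auto
      ultimately show ?thesis
        by linarith
    qed
    ultimately show ?thesis
      by linarith
  qed
  then show ?small ?large
    by auto
qed

text \<open>A centered Gaussian variable has \<open>exp (- variance / 2)\<close> as the expectation
  of its \<open>iexp\<close>. Without covariances the variance of a linear combination is additive,
  so the characteristic function factors.\<close>

lemma gaussian_uncorrelated_prob_Ball:
  fixes Y :: "'i \<Rightarrow> 'a \<Rightarrow> real"
  assumes "prob_space M" and I: "finite I"
    and gauss: "\<And>t. gaussian_rv M (\<lambda>x. \<Sum>i\<in>I. t i * Y i x)"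
    and mean: "\<And>i. i \<in> I \<Longrightarrow> integrable M (Y i)" "\<And>i. i \<in> I \<Longrightarrow> integral\<^sup>L M (Y i) = 0"
    and prod: "\<And>i j. i \<in> I \<Longrightarrow> j \<in> I \<Longrightarrow> integrable M (\<lambda>x. Y i x * Y j x)"
    and uncor: "\<And>i j. i \<in> I \<Longrightarrow> j \<in> I \<Longrightarrow> i \<noteq> j \<Longrightarrow> (LINT x|M. Y i x * Y j x) = 0"
    and A: "\<And>i. i \<in> I \<Longrightarrow> A i \<in> sets borel"
  shows "measure M {x \<in> space M. \<forall>i\<in>I. Y i x \<in> A i} = (\<Prod>i\<in>I. measure M {x \<in> space M. Y i x \<in> A i})"
proof (rule prob_Ball_eq_prod_if_char_factor)
  have *: "(CLINT x|M. iexp (\<Sum>i\<in>I. t i * Y i x)) = exp (- (\<Sum>i\<in>I. (t i)\<^sup>2 * (LINT x|M. (Y i x)\<^sup>2)) / 2)" for t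
  proof -
    have "(LINT x|M. (\<Sum>i\<in>I. t i * Y i x)\<^sup>2) = (LINT x|M. (\<Sum>i\<in>I. \<Sum>j\<in>I. (t i * t j) * (Y i x * Y j x)))"
      by (intro Bochner_Integration.integral_cong)
         (auto simp: power2_eq_square sum_product mult_ac)
    also have "\<dots> = (\<Sum>i\<in>I. \<Sum>j\<in>I. (t i * t j) * (LINT x|M. Y i x * Y j x))"
      using prod by (simp add: Bochner_Integration.integral_sum)
    also have "\<dots> = (\<Sum>i\<in>I. \<Sum>j\<in>I. if i = j then (t i)\<^sup>2 * (LINT x|M. (Y i x)\<^sup>2) else 0)"
      using uncor by (intro sum.cong) (auto simp: power2_eq_square)
    also have "\<dots> = (\<Sum>i\<in>I. (t i)\<^sup>2 * (LINT x|M. (Y i x)\<^sup>2))"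
      using I by (simp add: sum.delta)
    finally have var: "(LINT x|M. (\<Sum>i\<in>I. t i * Y i x)\<^sup>2) = \<dots>" .
    have "(LINT x|M. (\<Sum>i\<in>I. t i * Y i x)) = 0"
      using mean by (simp add: Bochner_Integration.integral_sum)
    from gaussian_rv_iexp[OF assms(1) gauss this] show ?thesis
      unfolding var .
  qed
  have single: "(CLINT x|M. iexp (t i * Y i x)) = exp (- (t i)\<^sup>2 * (LINT x|M. (Y i x)\<^sup>2) / 2)" if "i \<in> I" for t i
  proof -
    have "(\<Sum>j\<in>I. (if j = i then t i else 0) * Y j x) = t i * Y i x" for x
      using that I by (subst sum.remove[of _ i]) auto
    moreover have "(\<Sum>j\<in>I. (if j = i then t i else 0)\<^sup>2 * (LINT x|M. (Y j x)\<^sup>2)) = (t i)\<^sup>2 * (LINT x|M. (Y i x)\<^sup>2)"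
      using that I by (subst sum.remove[of _ i]) auto
    ultimately show ?thesis
      using *[of "\<lambda>j. if j = i then t i else 0"] by simp
  qed
  show "(CLINT x|M. iexp (\<Sum>i\<in>I. t i * Y i x)) = (\<Prod>i\<in>I. CLINT x|M. iexp (t i * Y i x))" for t
  proof -
    have "(\<Prod>i\<in>I. CLINT x|M. iexp (t i * Y i x)) =
        (\<Prod>i\<in>I. complex_of_real (exp (- (t i)\<^sup>2 * (LINT x|M. (Y i x)\<^sup>2) / 2)))"
      by (intro prod.cong single refl)
    also have "\<dots> = exp (- (\<Sum>i\<in>I. (t i)\<^sup>2 * (LINT x|M. (Y i x)\<^sup>2)) / 2)"
      using I by (simp only: of_real_prod[symmetric] exp_sum[symmetric] sum_negf[symmetric] sum_divide_distrib mult_minus_left)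
    finally show ?thesis
      unfolding * ..
  qed
qed (use assms in auto)

section \<open>The discrete Hartley transform\<close>

text \<open>Being real-valued, the Hartley transform treats all frequencies alike, whereas the real Fourier
  transform singles out the constant term and, on grids of even size, the Nyquist frequency.\<close>

definition cas :: "real \<Rightarrow> real" where
  "cas x = cos x + sin x"

text \<open>The cosine of the difference is the shape of a stationary covariance; the sine of the
  sum averages to 0, over a grid as well as under a symmetric measure.\<close>

lemma cas_mult: "cas x * cas y = cos (x - y) + sin (x + y)"
  by (simp add: cas_def cos_diff sin_add algebra_simps)

lemma abs_cas_le: "\<bar>cas x\<bar> \<le> 2"
  unfolding cas_def using abs_cos_le_one[of x] abs_sin_le_one[of x] by linarith

lemma borel_measurable_cas [measurable]: "cas \<in> borel_measurable borel"
  unfolding cas_def[abs_def] by measurable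

text \<open>A geometric sum whose ratio is an N-th root of unity. The phase \<open>a\<close> serves
  the inversion formula, where a symmetric range of frequencies is shifted to
  \<open>{..<N}\<close>.\<close>

lemma sum_cis_grid:
  fixes p :: int and a :: real and N :: nat
  assumes "N > 0"
  shows "(\<Sum>j<N. cis (2 * pi * p * real j / N + a)) = (if int N dvd p then N * cis a else 0)"
proof -
  define w where "w = cis (2 * pi * p / N)"
  have "w ^ j = cis (2 * pi * p * real j / N)" for j
    unfolding w_def Complex.DeMoivre by (simp add: mult_ac)
  then have sum: "(\<Sum>j<N. cis (2 * pi * p * real j / N + a)) = (\<Sum>j<N. w ^ j) * cis a"
    by (simp add: cis_mult[symmetric] sum_distrib_right)
  have "w ^ N = cis (2 * pi * p)"
    unfolding w_def Complex.DeMoivre using assms by simp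
  then have wN: "w ^ N = 1"
    by (simp add: cis_multiple_2pi)
  have "w = 1 \<longleftrightarrow> int N dvd p"
  proof
    assume "int N dvd p"
    then obtain q where "p = int N * q"
      by auto
    then have "2 * pi * p / N = 2 * pi * real_of_int q"
      using assms by simp
    then show "w = 1"
      by (simp add: w_def cis_multiple_2pi)
  next
    assume "w = 1"
    then have "cos (2 * pi * p / N) = 1"
      by (simp add: w_def complex_eq_iff)
    then obtain q :: int where "2 * pi * p / N = q * 2 * pi"
      by (auto simp: cos_one_2pi_int)
    then have "real_of_int p = real_of_int (q * int N)"
      using assms by (simp add: field_simps)
    then have "p = q * int N"
      by (simp only: of_int_eq_iff)
    then show "int N dvd p"
      by simp
  qed
  then show ?thesis
    using wN unfolding sum by (auto simp: geometric_sum)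
qed

lemma sum_cos_grid:
  assumes "N > 0"
  shows "(\<Sum>j<N. cos (2 * pi * real_of_int p * real j / N + a)) = (if int N dvd p then N * cos a else 0)"
  using arg_cong[OF sum_cis_grid[OF assms, of p a], of Re] by (auto split: if_splits)

lemma sum_sin_grid:
  assumes "N > 0"
  shows "(\<Sum>j<N. sin (2 * pi * real_of_int p * real j / N + a)) = (if int N dvd p then N * sin a else 0)"
  using arg_cong[OF sum_cis_grid[OF assms, of p a], of Im] by (auto split: if_splits)

text \<open>With the whole factor 1/N in the forward transform, a sampled \<open>cas\<close> of
  integer frequency has coefficients 0 and 1, and inversion needs no factor.\<close>

definition hartley :: "nat \<Rightarrow> int \<Rightarrow> (real \<Rightarrow> real) \<Rightarrow> real" where
  "hartley N k f = (\<Sum>j<N. cas (2 * pi * k * (real j / N)) / N * f (real j / N))"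

text \<open>Frequencies that agree modulo \<open>N\<close> are aliases of each other on the grid.\<close>

lemma hartley_cas:
  assumes "N > 0"
  shows "hartley N k (\<lambda>t. cas (t * (2 * pi * real_of_int m))) = (if int N dvd k - m then 1 else 0)"
proof -
  have "cas (2 * pi * real_of_int k * (real j / N)) / N * cas ((real j / N) * (2 * pi * real_of_int m)) =
      (cos (2 * pi * real_of_int (k - m) * real j / N + 0) + sin (2 * pi * real_of_int (k + m) * real j / N + 0)) / N" for j :: nat
    by (simp add: cas_mult algebra_simps add_divide_distrib diff_divide_distrib)
  then show ?thesis
    using assms unfolding hartley_def
    by (simp only: sum_divide_distrib[symmetric] sum.distrib sum_cos_grid sum_sin_grid) auto
qed

text \<open>Orthogonality with respect to the frequency. For odd \<open>N\<close> the symmetric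
  range is a complete residue system, made of the representatives of least modulus that the upper
  variance bound requires.\<close>

lemma hartley_inversion:
  fixes f :: "real \<Rightarrow> real"
  assumes N: "N = 2 * n + 1" and j: "j < N"
  shows "f (real j / N) = (\<Sum>k\<in>{- int n..int n}. hartley N k f * cas (2 * pi * k * (real j / N)))"
proof -
  have N0: "N > 0"
    using N by simp
  have bij: "bij_betw (\<lambda>l. int l - int n) {..<N} {- int n..int n}"
    by (rule bij_betwI[where g="\<lambda>k. nat (k + int n)"]) (auto simp: N)
  have orth: "(\<Sum>k\<in>{- int n..int n}. cas (2 * pi * k * (real i / N)) * cas (2 * pi * k * (real j / N))) = (if i = j then N else 0)"
    if "i < N" for i
  proof -
    define p q where "p = int i - int j" and "q = int i + int j"
    have "(\<Sum>k\<in>{- int n..int n}. cas (2 * pi * k * (real i / N)) * cas (2 * pi * k * (real j / N))) =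
        (\<Sum>l<N. cas (2 * pi * real_of_int (int l - int n) * (real i / N)) * cas (2 * pi * real_of_int (int l - int n) * (real j / N)))"
      by (rule sum.reindex_bij_betw[OF bij, symmetric])
    also have "\<dots> = (\<Sum>l<N. cos (2 * pi * real_of_int p * real l / N + (- 2 * pi * n * p / N)) + sin (2 * pi * real_of_int q * real l / N + (- 2 * pi * n * q / N)))"
      by (intro sum.cong) (auto simp: cas_mult p_def q_def field_simps)
    also have "\<dots> = (if int N dvd p then N * cos (- 2 * pi * n * p / N) else 0) + (if int N dvd q then N * sin (- 2 * pi * n * q / N) else 0)"
      using N0 by (simp only: sum.distrib sum_cos_grid sum_sin_grid)
    \<comment> \<open>\<open>N\<close> divides \<open>q = i + j\<close> only if \<open>i + j\<close>
      is 0 or \<open>N\<close>; the phase is then a multiple of 2 pi, so these pairs contribute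
      nothing.\<close>
    also have "(if int N dvd q then N * sin (- 2 * pi * n * q / N) else 0) = 0"
    proof -
      have "sin (- 2 * pi * n * q / N) = 0" if "int N dvd q"
      proof -
        from that obtain c where "q = int N * c"
          by auto
        then have "- 2 * pi * n * q / N = real_of_int (- 2 * int n * c) * pi"
          using N0 by simp
        then show ?thesis
          unfolding sin_zero_iff_int2 by blast
      qed
      then show ?thesis
        by auto
    qed
    also have "int N dvd p \<longleftrightarrow> i = j"
    proof -
      have "\<bar>p\<bar> < int N"
        using \<open>i < N\<close> j by (auto simp: p_def)
      then show ?thesis
        using zdvd_not_zless[of "\<bar>p\<bar>" "int N"] by (auto simp: p_def)
    qed
    finally show ?thesis
      by (simp add: p_def)
  qed
  have "(\<Sum>k\<in>{- int n..int n}. hartley N k f * cas (2 * pi * k * (real j / N))) =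
      (\<Sum>k\<in>{- int n..int n}. \<Sum>i<N. f (real i / N) / N * (cas (2 * pi * k * (real i / N)) * cas (2 * pi * k * (real j / N))))"
    unfolding hartley_def sum_distrib_right by (intro sum.cong refl) simp
  also have "\<dots> = (\<Sum>i<N. f (real i / N) / N * (\<Sum>k\<in>{- int n..int n}. cas (2 * pi * k * (real i / N)) * cas (2 * pi * k * (real j / N))))"
    by (subst sum.swap) (simp add: sum_distrib_left)
  also have "\<dots> = (\<Sum>i<N. if i = j then f (real j / N) else 0)"
    using N0 by (intro sum.cong refl, subst orth) auto
  also have "\<dots> = f (real j / N)"
    using j by simp
  finally show ?thesis ..
qed

lemma abs_hartley_le:
  assumes "N > 0" and "\<And>j. j < N \<Longrightarrow> \<bar>f (real j / N)\<bar> \<le> r"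
  shows "\<bar>hartley N k f\<bar> \<le> 2 * r"
proof -
  have "\<bar>hartley N k f\<bar> \<le> (\<Sum>j<N. \<bar>cas (2 * pi * k * (real j / N)) / N * f (real j / N)\<bar>)"
    unfolding hartley_def by (rule sum_abs)
  also have "\<dots> \<le> (\<Sum>j<N. 2 / N * r)"
    using assms abs_cas_le by (intro sum_mono) (auto simp: abs_mult intro!: mult_mono divide_right_mono)
  also have "\<dots> = 2 * r"
    using assms(1) by simp
  finally show ?thesis .
qed

lemma abs_hartley_inversion_le:
  fixes f :: "real \<Rightarrow> real"
  assumes "N = 2 * n + 1" "j < N" and "\<And>k. k \<in> {- int n..int n} \<Longrightarrow> \<bar>hartley N k f\<bar> \<le> w k"
  shows "\<bar>f (real j / N)\<bar> \<le> 2 * (\<Sum>k\<in>{- int n..int n}. w k)"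
proof -
  have "\<bar>f (real j / N)\<bar> \<le> (\<Sum>k\<in>{- int n..int n}. \<bar>hartley N k f * cas (2 * pi * k * (real j / N))\<bar>)"
    unfolding hartley_inversion[OF assms(1,2), of f] by (rule sum_abs)
  also have "\<dots> \<le> (\<Sum>k\<in>{- int n..int n}. w k * 2)"
    using assms(3) abs_cas_le by (intro sum_mono) (force simp: abs_mult intro!: mult_mono intro: order_trans[OF abs_ge_zero])
  also have "\<dots> = 2 * (\<Sum>k\<in>{- int n..int n}. w k)"
    by (simp add: sum_distrib_right[symmetric])
  finally show ?thesis .
qed

section \<open>The discrete spectral measure\<close>

text \<open>Used at \<open>a = 1 / 2\<close>, for the constant in the upper variance bound, and at
  \<open>a = 1 / 8\<close>, for the shares of the deviation.\<close>

lemma integrable_exp_abs_powr_count_space: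
  fixes \<nu> a :: real
  assumes "\<nu> > 0" "a > 0"
  shows "integrable (count_space UNIV) (\<lambda>k::int. exp (- a * \<bar>real_of_int k\<bar> powr \<nu>))"
proof -
  have "summable (\<lambda>n. exp (- a * real n powr \<nu>))"
  proof (rule summable_comparison_test_bigo)
    show "summable (\<lambda>n. norm (1 / real n ^ 2))"
      using inverse_power_summable[of 2, where 'a=real] by (simp add: field_simps)
    show "(\<lambda>n. exp (- a * real n powr \<nu>)) \<in> O(\<lambda>n. 1 / real n ^ 2)"
      using assms by real_asymp
  qed
  then have nat: "Infinite_Set_Sum.abs_summable_on (\<lambda>n::nat. exp (- a * real n powr \<nu>)) UNIV"
    by (simp add: Infinite_Set_Sum.abs_summable_on_nat_iff')
  have "Infinite_Set_Sum.abs_summable_on (\<lambda>k::int. exp (- a * \<bar>real_of_int k\<bar> powr \<nu>)) (range int \<union> range (\<lambda>n. - int n))"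
    using nat by (intro Infinite_Set_Sum.abs_summable_on_union Infinite_Set_Sum.abs_summable_on_reindex) auto
  also have "range int \<union> range (\<lambda>n. - int n) = UNIV"
  proof (rule set_eqI)
    show "k \<in> range int \<union> range (\<lambda>n. - int n) \<longleftrightarrow> k \<in> UNIV" for k
      by (cases k rule: int_cases2) auto
  qed
  finally show ?thesis
    by (simp add: Infinite_Set_Sum.abs_summable_on_def)
qed

lemma emeasure_discrete_spectral_measure_indicator:
  assumes "A \<in> sets borel"
  shows "emeasure (discrete_spectral_measure \<nu>) A =
    (\<integral>\<^sup>+k. ennreal (exp (- (\<bar>real_of_int k\<bar> powr \<nu>))) * indicator A (2 * pi * real_of_int k) \<partial>count_space UNIV)"
  using assms by (simp add: emeasure_discrete_spectral_measure)

lemma AE_discrete_spectral_measure: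
  "AE u in discrete_spectral_measure \<nu>. u \<in> range (\<lambda>m::int. 2 * pi * m)"
proof (rule AE_I)
  let ?B = "- range (\<lambda>m::int. 2 * pi * m)"
  have B: "?B \<in> sets borel"
    by (rule borel_comp[OF sets.countable]) auto
  show "?B \<in> sets (discrete_spectral_measure \<nu>)"
    using B by simp
  show "{u \<in> space (discrete_spectral_measure \<nu>). u \<notin> range (\<lambda>m::int. 2 * pi * m)} \<subseteq> ?B"
    by auto
  show "emeasure (discrete_spectral_measure \<nu>) ?B = 0"
    by (subst emeasure_discrete_spectral_measure_indicator[OF B]) (simp add: nn_integral_0_iff_AE)
qed

text \<open>\<open>k\<close> lies in its own class, and the aliases only add mass.\<close>

lemma measure_discrete_spectral_measure_ge:
  assumes "finite_measure (discrete_spectral_measure \<nu>)"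
  shows "exp (- (\<bar>real_of_int k\<bar> powr \<nu>)) \<le> measure (discrete_spectral_measure \<nu>) ((\<lambda>m. 2 * pi * real_of_int m) ` {m. d dvd k - m})"
proof -
  interpret finite_measure "discrete_spectral_measure \<nu>" by fact
  let ?A = "(\<lambda>m. 2 * pi * real_of_int m) ` {m. d dvd k - m}"
  have A: "?A \<in> sets borel"
    by (rule sets.countable) auto
  have "ennreal (exp (- (\<bar>real_of_int k\<bar> powr \<nu>))) =
      (\<integral>\<^sup>+m. ennreal (exp (- (\<bar>real_of_int m\<bar> powr \<nu>))) * indicator {k} m \<partial>count_space UNIV)"
    by (subst nn_integral_indicator_singleton) (auto simp: mult.commute)
  also have "\<dots> \<le> (\<integral>\<^sup>+m. ennreal (exp (- (\<bar>real_of_int m\<bar> powr \<nu>))) * indicator ?A (2 * pi * real_of_int m) \<partial>count_space UNIV)"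
    by (intro nn_integral_mono) (auto simp: indicator_def)
  also have "\<dots> = emeasure (discrete_spectral_measure \<nu>) ?A"
    by (rule emeasure_discrete_spectral_measure_indicator[OF A, symmetric])
  finally show ?thesis
    by (simp add: emeasure_eq_measure)
qed

text \<open>The point is that \<open>k\<close> has the least modulus in its class modulo \<open>2 * n + 1\<close>.\<close>

lemma measure_discrete_spectral_measure_le:
  assumes "finite_measure (discrete_spectral_measure \<nu>)" and "\<nu> > 0" and k: "k \<in> {- int n..int n}"
  shows "measure (discrete_spectral_measure \<nu>) ((\<lambda>m. 2 * pi * real_of_int m) ` {m. (2 * int n + 1) dvd k - m})
    \<le> exp (- (\<bar>real_of_int k\<bar> powr \<nu>) / 2) * (LINT m|count_space UNIV. exp (- (1 / 2) * \<bar>real_of_int m\<bar> powr \<nu>))"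
proof -
  interpret finite_measure "discrete_spectral_measure \<nu>" by fact
  let ?A = "(\<lambda>m. 2 * pi * real_of_int m) ` {m. (2 * int n + 1) dvd k - m}"
  let ?C = "LINT m|count_space UNIV. exp (- (1 / 2) * \<bar>real_of_int m\<bar> powr \<nu>)"
  have A: "?A \<in> sets borel"
    by (rule sets.countable) auto
  \<comment> \<open>One half of the exponent is estimated by
    \<open>\<bar>k\<bar> \<le> \<bar>m\<bar>\<close>, the other half is kept to make the sum over
    \<open>m\<close> converge to a constant independent of \<open>n\<close>.\<close>
  have le: "exp (- (\<bar>real_of_int m\<bar> powr \<nu>)) \<le> exp (- (\<bar>real_of_int k\<bar> powr \<nu>) / 2) * exp (- (1 / 2) * \<bar>real_of_int m\<bar> powr \<nu>)"
    if "(2 * int n + 1) dvd k - m" for m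
  proof -
    have "\<bar>k\<bar> \<le> \<bar>m\<bar>"
    proof (rule ccontr)
      assume "\<not> \<bar>k\<bar> \<le> \<bar>m\<bar>"
      then have "\<bar>k - m\<bar> < 2 * int n + 1" "k \<noteq> m"
        using k by auto
      then show False
        using that dvd_imp_le_int[of "k - m" "2 * int n + 1"] by auto
    qed
    then have "\<bar>real_of_int k\<bar> powr \<nu> \<le> \<bar>real_of_int m\<bar> powr \<nu>"
      using assms(2) by (intro powr_mono2) auto
    then show ?thesis
      by (simp add: exp_add[symmetric])
  qed
  have "emeasure (discrete_spectral_measure \<nu>) ?A =
      (\<integral>\<^sup>+m. ennreal (exp (- (\<bar>real_of_int m\<bar> powr \<nu>))) * indicator ?A (2 * pi * real_of_int m) \<partial>count_space UNIV)"
    by (rule emeasure_discrete_spectral_measure_indicator[OF A])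
  also have "\<dots> \<le> (\<integral>\<^sup>+m. ennreal (exp (- (\<bar>real_of_int k\<bar> powr \<nu>) / 2) * exp (- (1 / 2) * \<bar>real_of_int m\<bar> powr \<nu>)) \<partial>count_space UNIV)"
    using le by (intro nn_integral_mono) (auto simp: indicator_def intro!: ennreal_leI)
  also have "\<dots> = ennreal (LINT m|count_space UNIV. exp (- (\<bar>real_of_int k\<bar> powr \<nu>) / 2) * exp (- (1 / 2) * \<bar>real_of_int m\<bar> powr \<nu>))"
    using assms(2) by (intro nn_integral_eq_integral integrable_mult_right integrable_exp_abs_powr_count_space) auto
  also have "\<dots> = ennreal (exp (- (\<bar>real_of_int k\<bar> powr \<nu>) / 2) * ?C)"
    by simp
  finally show ?thesis
    by (simp add: emeasure_eq_measure ennreal_le_iff Bochner_Integration.integral_nonneg)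
qed

text \<open>The covariance becomes an integral of products of one real function at \<open>s\<close>
  and at \<open>t\<close>. Hence a bilinear expression in the process has as its expectation the
  integral of the same expression in \<open>\<lambda>t. cas (t * u)\<close>.\<close>

lemma has_spectral_measure_cas:
  assumes "has_spectral_measure M X F"
  shows "(LINT \<omega>|M. X s \<omega> * X t \<omega>) = (LINT u|F. cas (s * u) * cas (t * u))"
proof -
  have [measurable_cong]: "sets F = sets borel" and "finite_measure F" and sym: "distr F borel uminus = F"
    and eq: "complex_of_real (LINT \<omega>|M. X s \<omega> * X t \<omega>) = (CLINT u|F. iexp ((s - t) * u))"
    using assms by (auto simp: has_spectral_measure_def)
  interpret finite_measure F by fact
  have int: "complex_integrable F (\<lambda>u. iexp ((s - t) * u))"
    by (rule integrable_const_bound[where B=1]) auto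
  have "(LINT \<omega>|M. X s \<omega> * X t \<omega>) = Re (CLINT u|F. iexp ((s - t) * u))"
    unfolding eq[symmetric] by simp
  also have "\<dots> = (LINT u|F. cos ((s - t) * u))"
    by (subst integral_Re[OF int, symmetric]) (simp add: Re_exp)
  finally have cos: "(LINT \<omega>|M. X s \<omega> * X t \<omega>) = (LINT u|F. cos ((s - t) * u))" .
  \<comment> \<open>The sine is odd and \<open>F\<close> is symmetric.\<close>
  have "(LINT u|F. sin ((s + t) * u)) = (LINT u|distr F borel uminus. sin ((s + t) * u))"
    by (simp add: sym)
  also have "\<dots> = - (LINT u|F. sin ((s + t) * u))"
    by (subst integral_distr) auto
  finally have sin: "(LINT u|F. sin ((s + t) * u)) = 0"
    by simp
  have "(LINT u|F. cas (s * u) * cas (t * u)) = (LINT u|F. cos ((s - t) * u) + sin ((s + t) * u))"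
    by (simp add: cas_mult algebra_simps)
  also have "\<dots> = (LINT u|F. cos ((s - t) * u)) + (LINT u|F. sin ((s + t) * u))"
    by (intro Bochner_Integration.integral_add integrable_const_bound[where B=1]) auto
  finally show ?thesis
    by (simp add: cos sin)
qed

lemma hartley_product_expectation:
  assumes "has_spectral_measure M X F"
  shows "integrable M (\<lambda>\<omega>. hartley N k (\<lambda>t. X t \<omega>) * hartley N l (\<lambda>t. X t \<omega>))"
    and "(LINT \<omega>|M. hartley N k (\<lambda>t. X t \<omega>) * hartley N l (\<lambda>t. X t \<omega>)) =
      (LINT u|F. hartley N k (\<lambda>t. cas (t * u)) * hartley N l (\<lambda>t. cas (t * u)))"
proof -
  have [measurable_cong]: "sets F = sets borel" and "finite_measure F"
    and int: "integrable M (\<lambda>\<omega>. X s \<omega> * X t \<omega>)" for s t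
    using assms by (auto simp: has_spectral_measure_def)
  interpret finite_measure F by fact
  have int': "integrable F (\<lambda>u. cas (s * u) * cas (t * u))" for s t
  proof (rule integrable_const_bound[where B="2 * 2"])
    show "AE u in F. norm (cas (s * u) * cas (t * u)) \<le> 2 * 2"
      unfolding real_norm_def abs_mult by (intro AE_I2 mult_mono abs_cas_le) auto
  qed simp
  define c where "c i j = cas (2 * pi * k * (real i / N)) / N * (cas (2 * pi * l * (real j / N)) / N)" for i j :: nat
  have *: "hartley N k f * hartley N l f = (\<Sum>i<N. \<Sum>j<N. c i j * (f (real i / N) * f (real j / N)))" for f
    unfolding hartley_def c_def sum_product by (intro sum.cong) auto
  show "integrable M (\<lambda>\<omega>. hartley N k (\<lambda>t. X t \<omega>) * hartley N l (\<lambda>t. X t \<omega>))"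
    unfolding * using int by auto
  show "(LINT \<omega>|M. hartley N k (\<lambda>t. X t \<omega>) * hartley N l (\<lambda>t. X t \<omega>)) =
      (LINT u|F. hartley N k (\<lambda>t. cas (t * u)) * hartley N l (\<lambda>t. cas (t * u)))"
    unfolding * using int int' by (simp add: Bochner_Integration.integral_sum del: times_divide_eq_left add: has_spectral_measure_cas[OF assms])
qed

text \<open>A frequency \<open>m\<close> contributes to coefficient \<open>k\<close> only if the two
  are congruent modulo \<open>N\<close>, and it cannot be congruent to both \<open>k\<close> and
  \<open>l\<close>.\<close>

lemma hartley_uncorrelated:
  assumes "has_spectral_measure M X (discrete_spectral_measure \<nu>)" "N > 0" "\<not> int N dvd k - l"
  shows "(LINT \<omega>|M. hartley N k (\<lambda>t. X t \<omega>) * hartley N l (\<lambda>t. X t \<omega>)) = 0"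
proof -
  let ?F = "discrete_spectral_measure \<nu>"
  have "AE u in ?F. hartley N k (\<lambda>t. cas (t * u)) * hartley N l (\<lambda>t. cas (t * u)) = 0"
    using AE_discrete_spectral_measure
  proof eventually_elim
    case (elim u)
    then obtain m :: int where u: "u = 2 * pi * m"
      by auto
    have "\<not> (int N dvd k - m \<and> int N dvd l - m)"
      using assms(3) dvd_diff[of "int N" "k - m" "l - m"] by auto
    then show ?case
      using assms(2) by (auto simp: u hartley_cas)
  qed
  then have "(LINT u|?F. hartley N k (\<lambda>t. cas (t * u)) * hartley N l (\<lambda>t. cas (t * u))) = 0"
    by (rule integral_eq_zero_AE)
  then show ?thesis
    by (simp add: hartley_product_expectation(2)[OF assms(1)])
qed

lemma hartley_variance:
  assumes "has_spectral_measure M X (discrete_spectral_measure \<nu>)" "N > 0"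
  shows "(LINT \<omega>|M. (hartley N k (\<lambda>t. X t \<omega>))\<^sup>2) =
    measure (discrete_spectral_measure \<nu>) ((\<lambda>m. 2 * pi * real_of_int m) ` {m. int N dvd k - m})"
proof -
  let ?F = "discrete_spectral_measure \<nu>"
  let ?A = "(\<lambda>m. 2 * pi * real_of_int m) ` {m. int N dvd k - m}"
  have A [measurable]: "?A \<in> sets borel"
    by (rule sets.countable) auto
  have "(LINT \<omega>|M. (hartley N k (\<lambda>t. X t \<omega>))\<^sup>2) = (LINT u|?F. (hartley N k (\<lambda>t. cas (t * u)))\<^sup>2)"
    unfolding power2_eq_square by (rule hartley_product_expectation(2)[OF assms(1)])
  also have "\<dots> = (LINT u|?F. indicator ?A u)"
  proof (rule integral_cong_AE)
    show "AE u in ?F. (hartley N k (\<lambda>t. cas (t * u)))\<^sup>2 = indicator ?A u"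
      using AE_discrete_spectral_measure
    proof eventually_elim
      case (elim u)
      then obtain m :: int where u: "u = 2 * pi * m"
        by auto
      then have "u \<in> ?A \<longleftrightarrow> int N dvd k - m"
        by (auto simp: image_iff)
      then show ?case
        using assms(2) by (simp add: u hartley_cas indicator_def)
    qed
    show "(\<lambda>u. (hartley N k (\<lambda>t. cas (t * u)))\<^sup>2) \<in> borel_measurable ?F"
      unfolding hartley_def measurable_cong_sets[OF sets_discrete_spectral_measure refl] by measurable
    show "indicator ?A \<in> borel_measurable ?F"
      unfolding measurable_cong_sets[OF sets_discrete_spectral_measure refl] by measurable
  qed
  also have "\<dots> = measure ?F ?A"
    by simp
  finally show ?thesis .
qed

section \<open>Small deviations\<close>

lemma finite_sum_le_integral_count_space:
  fixes f :: "'i \<Rightarrow> real"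
  assumes "integrable (count_space UNIV) f" "\<And>i. 0 \<le> f i" "finite S"
  shows "sum f S \<le> integral\<^sup>L (count_space UNIV) f"
proof -
  have "sum f S = integral\<^sup>L (count_space S) f"
    using lebesgue_integral_count_space_finite[OF assms(3), of f] by simp
  also have "\<dots> = (LINT i|count_space UNIV. indicator S i *\<^sub>R f i)"
    using integral_restrict_space[of S "count_space UNIV" f] by (simp add: restrict_count_space)
  also have "\<dots> \<le> integral\<^sup>L (count_space UNIV) f"
    using assms integrable_mult_indicator[OF _ assms(1), of S]
    by (intro integral_mono) (auto simp: indicator_def)
  finally show ?thesis .
qed

section \<open>From triadic grids to the supremum\<close>

lemma continuous_le_from_triadic:
  fixes f :: "real \<Rightarrow> real"
  assumes cont: "continuous_on UNIV f"
    and grid: "\<And>m j :: nat. j < 3 ^ m \<Longrightarrow> \<bar>f (real j / real (3 ^ m))\<bar> \<le> r"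
    and t: "t \<in> {0..1}"
  shows "\<bar>f t\<bar> \<le> r"
proof -
  \<comment> \<open>The factor \<open>3 ^ m - 1\<close> instead of \<open>3 ^ m\<close> keeps the
    index below \<open>3 ^ m\<close> even at \<open>t = 1\<close>; together with rounding this moves
    the grid point by at most \<open>2 / 3 ^ m\<close>.\<close>
  define j where "j m = nat \<lfloor>t * (3 ^ m - 1)\<rfloor>" for m :: nat
  have pos: "0 \<le> t * (3 ^ m - 1)" for m :: nat
    using t by simp
  have j: "real (j m) \<le> t * (3 ^ m - 1)" "t * (3 ^ m - 1) - 1 < real (j m)" for m
    using pos[of m] unfolding j_def by linarith+
  have le: "t * (3 ^ m - 1) \<le> 3 ^ m - 1" for m :: nat
    using t by (simp add: mult_left_le_one_le)
  have j_less: "j m < 3 ^ m" for m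
  proof -
    have "real (j m) < real (3 ^ m)"
      unfolding of_nat_power of_nat_numeral using j(1)[of m] le[of m] by linarith
    then show ?thesis
      by (simp only: of_nat_less_iff)
  qed
  have "(\<lambda>m. real (j m) / real (3 ^ m)) \<longlonglongrightarrow> t"
  proof (rule tendsto_sandwich)
    show "\<forall>\<^sub>F m in sequentially. t - 2 / 3 ^ m \<le> real (j m) / real (3 ^ m)"
    proof (intro always_eventually allI)
      fix m
      have "t * 3 ^ m - 2 \<le> real (j m)"
        using j(2)[of m] t by (simp add: algebra_simps)
      then have "t \<le> (real (j m) + 2) / 3 ^ m"
        by (simp add: pos_le_divide_eq)
      then show "t - 2 / 3 ^ m \<le> real (j m) / real (3 ^ m)"
        by (simp add: add_divide_distrib)
    qed
    show "\<forall>\<^sub>F m in sequentially. real (j m) / real (3 ^ m) \<le> t"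
    proof (intro always_eventually allI)
      fix m
      have "real (j m) \<le> t * 3 ^ m"
        using j(1)[of m] t by (simp add: algebra_simps)
      then show "real (j m) / real (3 ^ m) \<le> t"
        by (simp add: pos_divide_le_eq)
    qed
    show "(\<lambda>m. t - 2 / 3 ^ m) \<longlonglongrightarrow> t"
      by real_asymp
  qed simp
  then have "(\<lambda>m. \<bar>f (real (j m) / real (3 ^ m))\<bar>) \<longlonglongrightarrow> \<bar>f t\<bar>"
    using cont by (intro tendsto_rabs isCont_tendsto_compose[of t f]) (auto simp: continuous_on_eq_continuous_at)
  then show ?thesis
    by (rule LIMSEQ_le_const2) (use grid j_less in auto)
qed

text \<open>Triadic grids are nested and have an odd number of points, as \<open>hartley_inversion\<close> requires.\<close>

lemma SUP_abs_le_iff_triadic: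
  fixes f :: "real \<Rightarrow> real"
  assumes cont: "continuous_on UNIV f"
  shows "(SUP t\<in>{0..1}. \<bar>f t\<bar>) \<le> r \<longleftrightarrow> (\<forall>m j :: nat. j < 3 ^ m \<longrightarrow> \<bar>f (real j / real (3 ^ m))\<bar> \<le> r)"
proof
  assume *: "\<forall>m j :: nat. j < 3 ^ m \<longrightarrow> \<bar>f (real j / real (3 ^ m))\<bar> \<le> r"
  show "(SUP t\<in>{0..1}. \<bar>f t\<bar>) \<le> r"
    using continuous_le_from_triadic[OF cont, of r] * by (intro cSUP_least) auto
next
  assume *: "(SUP t\<in>{0..1}. \<bar>f t\<bar>) \<le> r"
  \<comment> \<open>A real \<open>SUP\<close> is known to dominate its elements only when they are
    bounded above.\<close>
  have "bdd_above ((\<lambda>t. \<bar>f t\<bar>) ` {0..1})"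
    by (intro bounded_imp_bdd_above compact_imp_bounded compact_continuous_image continuous_on_rabs
        continuous_on_subset[OF cont]) auto
  then have "\<bar>f t\<bar> \<le> r" if "t \<in> {0..1}" for t
    using cSUP_upper[OF that, of "\<lambda>t. \<bar>f t\<bar>"] * by linarith
  moreover have "real j / real (3 ^ m) \<in> {0..1}" if "j < 3 ^ m" for m j :: nat
  proof -
    have "real j \<le> real (3 ^ m)"
      using that by (simp only: of_nat_le_iff)
    then show ?thesis
      by simp
  qed
  ultimately show "\<forall>m j :: nat. j < 3 ^ m \<longrightarrow> \<bar>f (real j / real (3 ^ m))\<bar> \<le> r"
    by blast
qed

section \<open>The Hartley coefficients of the process\<close>

locale discrete_spectral_process = prob_space M for M :: "'a measure" +
  fixes X :: "real \<Rightarrow> 'a \<Rightarrow> real" and \<nu> :: real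
  assumes \<nu>_pos: "\<nu> > 0"
    and gaussian: "gaussian_process M X"
    and centered: "centered_process M X"
    and continuous: "continuous_paths M X"
    and spectral: "has_spectral_measure M X (discrete_spectral_measure \<nu>)"
begin

definition Z :: "nat \<Rightarrow> int \<Rightarrow> 'a \<Rightarrow> real" where
  "Z N k \<omega> = hartley N k (\<lambda>t. X t \<omega>)"

lemma integrable_X [simp, intro]: "integrable M (X t)"
  using centered by (simp add: centered_process_def)

lemma measurable_X [measurable]: "X t \<in> borel_measurable M"
  using integrable_X by (rule borel_measurable_integrable)

lemma continuous_X: "\<omega> \<in> space M \<Longrightarrow> continuous_on UNIV (\<lambda>t. X t \<omega>)"
  using continuous by (simp add: continuous_paths_def)

lemma measurable_Z [measurable]: "Z N k \<in> borel_measurable M"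
  unfolding Z_def[abs_def] hartley_def by measurable

lemma integrable_Z: "integrable M (Z N k)"
  unfolding Z_def[abs_def] hartley_def by auto

lemma expectation_Z: "expectation (Z N k) = 0"
  unfolding Z_def[abs_def] hartley_def using centered
  by (simp add: centered_process_def Bochner_Integration.integral_sum)

lemma gaussian_rv_sum_Z:
  assumes "N > 0"
  shows "gaussian_rv M (\<lambda>\<omega>. \<Sum>k\<in>K. c k * Z N k \<omega>)"
proof -
  define d where "d s = (\<Sum>k\<in>K. c k * (cas (2 * pi * real_of_int k * s) / N))" for s
  \<comment> \<open>\<open>gaussian_process\<close> sums over a set of times, so the grid points
    have to be distinct.\<close>
  have inj: "inj_on (\<lambda>j. real j / N) {..<N}"
    using assms by (auto simp: inj_on_def)
  have "(\<Sum>k\<in>K. c k * Z N k \<omega>) = (\<Sum>s\<in>(\<lambda>j. real j / N) ` {..<N}. d s * X s \<omega>)" for \<omega>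
    unfolding Z_def hartley_def d_def sum_distrib_left sum_distrib_right sum.reindex[OF inj] o_def
    by (subst sum.swap) (simp add: mult.assoc)
  then show ?thesis
    using gaussian by (simp add: gaussian_process_def)
qed

lemma gaussian_rv_Z:
  assumes "N > 0"
  shows "gaussian_rv M (Z N k)"
  using gaussian_rv_sum_Z[OF assms, of "\<lambda>_. 1" "{k}"] by simp

lemma variance_Z:
  assumes "N > 0"
  shows "expectation (\<lambda>\<omega>. (Z N k \<omega>)\<^sup>2) =
    measure (discrete_spectral_measure \<nu>) ((\<lambda>m. 2 * pi * real_of_int m) ` {m. int N dvd k - m})"
  unfolding Z_def by (rule hartley_variance[OF spectral assms])

lemma finite_spectral: "finite_measure (discrete_spectral_measure \<nu>)"
  using spectral by (simp add: has_spectral_measure_def)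

lemma prob_Z_Ball:
  assumes "N > 0" "finite K"
    and incongruent: "\<And>k l. k \<in> K \<Longrightarrow> l \<in> K \<Longrightarrow> k \<noteq> l \<Longrightarrow> \<bar>k - l\<bar> < int N"
    and "\<And>k. k \<in> K \<Longrightarrow> A k \<in> sets borel"
  shows "prob {\<omega> \<in> space M. \<forall>k\<in>K. Z N k \<omega> \<in> A k} = (\<Prod>k\<in>K. prob {\<omega> \<in> space M. Z N k \<omega> \<in> A k})"
proof (rule gaussian_uncorrelated_prob_Ball)
  show "expectation (\<lambda>\<omega>. Z N k \<omega> * Z N l \<omega>) = 0" if "k \<in> K" "l \<in> K" "k \<noteq> l" for k l
  proof -
    have "\<not> int N dvd k - l"
      using incongruent[OF that] that(3) dvd_imp_le_int[of "k - l" "int N"] by auto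
    then show ?thesis
      unfolding Z_def by (rule hartley_uncorrelated[OF spectral assms(1)])
  qed
  show "integrable M (\<lambda>\<omega>. Z N k \<omega> * Z N l \<omega>)" for k l
    unfolding Z_def by (rule hartley_product_expectation(1)[OF spectral])
qed (use assms gaussian_rv_sum_Z integrable_Z expectation_Z prob_space_axioms in auto)

section \<open>Upper bound for the probability\<close>

text \<open>The lower variance bound holds for any representative of a class, so the frequencies
  \<open>{0..int n}\<close> on a grid of \<open>n + 1\<close> points will do, whatever the parity.
  Each variance is at least \<open>exp (- (real n powr \<nu>))\<close>.\<close>

lemma prob_SUP_le:
  assumes r: "r > 0"
  shows "prob {\<omega> \<in> space M. (SUP t\<in>{0..1}. \<bar>X t \<omega>\<bar>) \<le> r} \<le> (2 * r * exp (real n powr \<nu> / 2)) ^ Suc n"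
proof -
  define K where "K = {0..int n}"
  have "prob {\<omega> \<in> space M. (SUP t\<in>{0..1}. \<bar>X t \<omega>\<bar>) \<le> r} \<le>
      prob {\<omega> \<in> space M. \<forall>k\<in>K. Z (Suc n) k \<omega> \<in> {- (2 * r)..2 * r}}"
  proof (rule finite_measure_mono)
    show "{\<omega> \<in> space M. \<forall>k\<in>K. Z (Suc n) k \<omega> \<in> {- (2 * r)..2 * r}} \<in> events"
      unfolding K_def by measurable
    show "{\<omega> \<in> space M. (SUP t\<in>{0..1}. \<bar>X t \<omega>\<bar>) \<le> r} \<subseteq> {\<omega> \<in> space M. \<forall>k\<in>K. Z (Suc n) k \<omega> \<in> {- (2 * r)..2 * r}}"
    proof clarify
      fix \<omega> k assume \<omega>: "\<omega> \<in> space M" "(SUP t\<in>{0..1}. \<bar>X t \<omega>\<bar>) \<le> r"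
      then have "\<bar>X t \<omega>\<bar> \<le> r" if "t \<in> {0..1}" for t
        using that continuous_le_from_triadic[OF continuous_X[OF \<omega>(1)], of r t]
        by (simp add: SUP_abs_le_iff_triadic[OF continuous_X[OF \<omega>(1)]])
      then have "\<bar>Z (Suc n) k \<omega>\<bar> \<le> 2 * r"
        unfolding Z_def by (intro abs_hartley_le) auto
      then show "Z (Suc n) k \<omega> \<in> {- (2 * r)..2 * r}"
        by auto
    qed
  qed
  also have "\<dots> = (\<Prod>k\<in>K. prob {\<omega> \<in> space M. Z (Suc n) k \<omega> \<in> {- (2 * r)..2 * r}})"
    by (rule prob_Z_Ball) (auto simp: K_def)
  also have "\<dots> \<le> (\<Prod>k\<in>K. 2 * r * exp (real n powr \<nu> / 2))"
  proof (intro prod_mono conjI)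
    fix k assume k: "k \<in> K"
    have "prob {\<omega> \<in> space M. Z (Suc n) k \<omega> \<in> {- (2 * r)..2 * r}} \<le> 2 * r / exp (- (\<bar>real_of_int k\<bar> powr \<nu>) / 2)"
    proof (rule gaussian_rv_prob_le)
      have "(exp (- (\<bar>real_of_int k\<bar> powr \<nu>) / 2))\<^sup>2 = exp (- (\<bar>real_of_int k\<bar> powr \<nu>))"
        by (simp add: power2_eq_square exp_add[symmetric])
      then show "(exp (- (\<bar>real_of_int k\<bar> powr \<nu>) / 2))\<^sup>2 \<le> expectation (\<lambda>\<omega>. (Z (Suc n) k \<omega>)\<^sup>2)"
        using measure_discrete_spectral_measure_ge[OF finite_spectral] by (simp add: variance_Z)
    qed (use r prob_space_axioms gaussian_rv_Z expectation_Z in auto)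
    also have "\<dots> = 2 * r * exp (\<bar>real_of_int k\<bar> powr \<nu> / 2)"
      by (simp add: exp_minus field_simps)
    also have "\<dots> \<le> 2 * r * exp (real n powr \<nu> / 2)"
      using r k \<nu>_pos by (auto simp: K_def intro!: powr_mono2)
    finally show "prob {\<omega> \<in> space M. Z (Suc n) k \<omega> \<in> {- (2 * r)..2 * r}} \<le> 2 * r * exp (real n powr \<nu> / 2)" .
  qed simp
  also have "\<dots> = (2 * r * exp (real n powr \<nu> / 2)) ^ Suc n"
    by (simp add: K_def nat_add_distrib)
  finally show ?thesis .
qed

section \<open>Lower bound for the probability\<close>

text \<open>The grid events decrease because the grids are nested, and by continuity of the paths
  they intersect in the event for the supremum; continuity from above preserves a bound common to
  all grids.\<close>

lemma prob_SUP_ge_if_grid: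
  assumes "\<And>m. q \<le> prob {\<omega> \<in> space M. \<forall>j<3 ^ m. \<bar>X (real j / real (3 ^ m)) \<omega>\<bar> \<le> r}"
  shows "q \<le> prob {\<omega> \<in> space M. (SUP t\<in>{0..1}. \<bar>X t \<omega>\<bar>) \<le> r}"
proof -
  define E where "E m = {\<omega> \<in> space M. \<forall>j<3 ^ m. \<bar>X (real j / real (3 ^ m)) \<omega>\<bar> \<le> r}" for m :: nat
  have "E (Suc m) \<subseteq> E m" for m
  proof
    fix \<omega> assume \<omega>: "\<omega> \<in> E (Suc m)"
    have "\<bar>X (real j / real (3 ^ m)) \<omega>\<bar> \<le> r" if "j < 3 ^ m" for j
    proof -
      have "3 * j < 3 ^ Suc m"
        using that by simp
      moreover have "real (3 * j) / real (3 ^ Suc m) = real j / real (3 ^ m)"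
        by simp
      ultimately show ?thesis
        using \<omega> unfolding E_def by (metis (mono_tags, lifting) mem_Collect_eq)
    qed
    then show "\<omega> \<in> E m"
      using \<omega> by (auto simp: E_def)
  qed
  then have "decseq E"
    by (rule decseq_SucI)
  moreover have "range E \<subseteq> events"
    unfolding E_def by (auto; measurable)
  ultimately have "(\<lambda>m. prob (E m)) \<longlonglongrightarrow> prob (\<Inter>m. E m)"
    by (intro finite_Lim_measure_decseq)
  then have "q \<le> prob (\<Inter>m. E m)"
    by (rule LIMSEQ_le_const) (use assms in \<open>auto simp: E_def\<close>)
  also have "(\<Inter>m. E m) = {\<omega> \<in> space M. (SUP t\<in>{0..1}. \<bar>X t \<omega>\<bar>) \<le> r}"
    using SUP_abs_le_iff_triadic[OF continuous_X] by (auto simp: E_def)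
  finally show ?thesis .
qed

text \<open>The coefficient of frequency \<open>k\<close> is allotted the share \<open>r * exp (- e / 8) / (2 * C)\<close> of the total
  deviation, where \<open>e = \<bar>k\<bar> powr \<nu>\<close>, while its standard deviation is at most \<open>C * exp (- e / 4)\<close>.
  Frequencies with \<open>e < T\<close> cost a factor proportional to \<open>r\<close> each; for the remaining ones Chebyshev's
  inequality gives a product bounded below by \<open>exp (- C)\<close>, and \<open>T\<close> is chosen so that
  \<open>exp (- T / 8) = r\<^sup>2 / (8 * C ^ 4)\<close>.\<close>

lemma prob_grid_ge:
  assumes r: "0 < r" "r < 1" and C: "1 \<le> C"
    and var: "(LINT m|count_space UNIV. exp (- (1 / 2) * \<bar>real_of_int m\<bar> powr \<nu>)) \<le> C"
    and weights: "\<And>S. finite S \<Longrightarrow> (\<Sum>k\<in>S. exp (- (1 / 8) * \<bar>real_of_int k\<bar> powr \<nu>)) \<le> C"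
    and T: "T = 16 * - ln r + 8 * ln (8 * C ^ 4)" and b: "T powr (1 / \<nu>) < real b + 1"
    and N: "N = 2 * n + 1"
  shows "(r / (8 * C ^ 2)) ^ (2 * b + 1) * exp (- C) \<le> prob {\<omega> \<in> space M. \<forall>j<N. \<bar>X (real j / N) \<omega>\<bar> \<le> r}"
proof -
  define K where "K = {- int n..int n}"
  define e where "e k = \<bar>real_of_int k\<bar> powr \<nu>" for k
  \<comment> \<open>The shares decay at half the rate of the deviations: they remain summable, while
    \<open>a k / s k\<close> grows like \<open>exp (e k / 8)\<close>. The 2 in the denominator
    offsets the bound 2 for \<open>cas\<close> in the inversion.\<close>
  define a where "a k = r * exp (- e k / 8) / (2 * C)" for k
  define s where "s k = C * exp (- e k / 4)" for k
  \<comment> \<open>In \<open>8 * C ^ 2\<close>, a factor 4 comes from the bound for short intervals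
    and \<open>2 * C ^ 2\<close> from the ratio \<open>a k / s k\<close>.\<close>
  define g where "g k = (if e k < T then r / (8 * C ^ 2) else exp (- exp (- e k / 8)))" for k
  have a_pos: "0 < a k" and s_pos: "0 < s k" and e_nonneg: "0 \<le> e k" for k
    using r C by (auto simp: a_def s_def e_def)
  have N0: "N > 0" and int_N: "int N = 2 * int n + 1"
    using N by simp_all
  have "1 \<le> C ^ 2"
    using C by (rule one_le_power)
  then have C2: "r \<le> 2 * C ^ 2" "r \<le> 8 * C ^ 2"
    using r by linarith+
  have g_le: "g k \<le> prob {\<omega> \<in> space M. Z N k \<omega> \<in> {- a k..a k}}" if k: "k \<in> K" for k
  proof -
    have "expectation (\<lambda>\<omega>. (Z N k \<omega>)\<^sup>2) \<le> exp (- e k / 2) * (LINT m|count_space UNIV. exp (- (1 / 2) * \<bar>real_of_int m\<bar> powr \<nu>))"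
      using measure_discrete_spectral_measure_le[OF finite_spectral \<nu>_pos, of k n] k
      by (simp add: variance_Z[OF N0] int_N K_def e_def)
    also have "\<dots> \<le> exp (- e k / 2) * C ^ 2"
      using var C power_increasing[of 1 2 C] by (intro mult_left_mono) auto
    also have "\<dots> = (s k)\<^sup>2"
      by (simp add: s_def power2_eq_square exp_add[symmetric])
    finally have var_le: "expectation (\<lambda>\<omega>. (Z N k \<omega>)\<^sup>2) \<le> (s k)\<^sup>2" .
    note ge = gaussian_rv_prob_ge[OF prob_space_axioms gaussian_rv_Z[OF N0] expectation_Z s_pos var_le a_pos[of k]]
    show ?thesis
    proof (cases "e k < T")
      case True
      have "a k / s k = r / (2 * C ^ 2) * (exp (- e k / 8) / exp (- e k / 4))"
        by (simp add: a_def s_def power2_eq_square)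
      also have "exp (- e k / 8) / exp (- e k / 4) = exp (e k / 8)"
        by (simp add: exp_diff[symmetric])
      finally have "a k / s k \<ge> r / (2 * C ^ 2)"
        using r e_nonneg[of k] by (simp add: divide_right_mono)
      moreover have "r / (2 * C ^ 2) \<le> 1"
        using r C C2 by (simp add: divide_le_eq)
      ultimately have "r / (2 * C ^ 2) / 4 \<le> min 1 (a k / s k) / 4"
        by (intro divide_right_mono) auto
      also note ge(1)
      finally show ?thesis
        using True by (simp add: g_def)
    next
      case False
      let ?v = "exp (- e k / 8)"
      have "exp (- T / 8) = r\<^sup>2 / (8 * C ^ 4)"
      proof -
        have "exp (- T / 8) = exp (2 * ln r - ln (8 * C ^ 4))"
          unfolding T by (simp add: field_simps)
        also have "\<dots> = exp (ln r) ^ 2 / exp (ln (8 * C ^ 4))"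
          by (simp add: exp_diff power2_eq_square exp_add[symmetric])
        finally show ?thesis
          using r C by simp
      qed
      moreover have "?v \<le> exp (- T / 8)"
        using False by simp
      ultimately have v_le: "?v \<le> r\<^sup>2 / (8 * C ^ 4)"
        by simp
      have "(s k)\<^sup>2 / (a k)\<^sup>2 = 4 * C ^ 4 / r\<^sup>2 * (exp (- e k / 4) / ?v)\<^sup>2"
        by (simp add: a_def s_def power2_eq_square power4_eq_xxxx mult_ac)
      also have "exp (- e k / 4) / ?v = ?v"
        by (simp add: exp_diff[symmetric])
      \<comment> \<open>One factor \<open>?v\<close> is spent, through the choice of
        \<open>T\<close>, on cancelling \<open>1 / r\<^sup>2\<close>; the other survives and is
        summable over \<open>k\<close>.\<close>
      also have "4 * C ^ 4 / r\<^sup>2 * ?v\<^sup>2 = (4 * C ^ 4 / r\<^sup>2 * ?v) * ?v"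
        by (simp add: power2_eq_square)
      also have "\<dots> \<le> (4 * C ^ 4 / r\<^sup>2 * (r\<^sup>2 / (8 * C ^ 4))) * ?v"
        using v_le C by (intro mult_right_mono mult_left_mono) auto
      also have "\<dots> = ?v / 2"
        using r C by simp
      finally have "1 - ?v / 2 \<le> prob {\<omega> \<in> space M. Z N k \<omega> \<in> {- a k..a k}}"
        using ge(2) by linarith
      \<comment> \<open>An exponential form turns the product over \<open>k\<close> into a sum. It
        follows from \<open>ln (1 - x) \<ge> - x - 2 * x\<^sup>2\<close> at
        \<open>x = ?v / 2\<close>, where \<open>?v \<le> 1\<close>.\<close>
      moreover have "exp (- ?v) \<le> 1 - ?v / 2"
      proof -
        have v1: "?v \<le> 1"
          using e_nonneg[of k] by simp
        then have "?v * ?v \<le> ?v"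
          by (intro mult_left_le) auto
        moreover have "2 * (?v / 2)\<^sup>2 = ?v * ?v / 2"
          by (simp add: power2_eq_square)
        ultimately have "- ?v \<le> - (?v / 2) - 2 * (?v / 2)\<^sup>2"
          by linarith
        also have "\<dots> \<le> ln (1 - ?v / 2)"
          using v1 by (intro ln_one_minus_pos_lower_bound) auto
        finally have "exp (- ?v) \<le> exp (ln (1 - ?v / 2))"
          by (simp only: exp_le_cancel_iff)
        also have "\<dots> = 1 - ?v / 2"
          using v1 by (intro exp_ln) linarith
        finally show ?thesis .
      qed
      ultimately show ?thesis
        using False by (simp add: g_def)
    qed
  qed
  have "(r / (8 * C ^ 2)) ^ (2 * b + 1) * exp (- C) \<le> prod g K"
  proof -
    let ?q = "r / (8 * C ^ 2)"
    have q: "0 \<le> ?q" "?q \<le> 1"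
      using r C C2 by (auto simp: divide_le_eq)
    have near: "\<bar>k\<bar> \<le> int b" if "e k < T" for k
    proof -
      have "\<bar>real_of_int k\<bar> = e k powr (1 / \<nu>)"
        using \<nu>_pos by (simp add: e_def powr_powr)
      also have "\<dots> \<le> T powr (1 / \<nu>)"
        using that e_nonneg \<nu>_pos by (intro powr_mono2) auto
      finally have "\<bar>real_of_int k\<bar> < real b + 1"
        using b by linarith
      then show ?thesis
        by linarith
    qed
    have "card (K \<inter> {k. e k < T}) \<le> card {- int b..int b}"
      using near by (intro card_mono) (fastforce simp: abs_le_iff)+
    then have card: "card (K \<inter> {k. e k < T}) \<le> 2 * b + 1"
      by (simp add: nat_add_distrib)
    have "prod g K = prod g (K \<inter> {k. e k < T}) * prod g (K \<inter> - {k. e k < T})"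
      by (subst prod.union_disjoint[symmetric]) (auto simp: K_def intro!: arg_cong[where f="prod g"])
    also have "prod g (K \<inter> {k. e k < T}) = ?q ^ card (K \<inter> {k. e k < T})"
      by (simp add: g_def)
    also have "prod g (K \<inter> - {k. e k < T}) = exp (- (\<Sum>k\<in>K \<inter> - {k. e k < T}. exp (- e k / 8)))"
      by (simp add: g_def K_def exp_sum sum_negf[symmetric])
    finally have prod: "prod g K = ?q ^ card (K \<inter> {k. e k < T}) * exp (- (\<Sum>k\<in>K \<inter> - {k. e k < T}. exp (- e k / 8)))" .
    \<comment> \<open>A coarse grid may have fewer frequencies with \<open>e k < T\<close>; as
      \<open>?q \<le> 1\<close>, the exponent \<open>2 * b + 1\<close> serves all grids.\<close>
    have "?q ^ (2 * b + 1) \<le> ?q ^ card (K \<inter> {k. e k < T})"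
      using q card by (intro power_decreasing) auto
    moreover have "(\<Sum>k\<in>K \<inter> - {k. e k < T}. exp (- e k / 8)) \<le> C"
      using weights[of "K \<inter> - {k. e k < T}"] by (simp add: K_def e_def)
    then have "exp (- C) \<le> exp (- (\<Sum>k\<in>K \<inter> - {k. e k < T}. exp (- e k / 8)))"
      by simp
    ultimately show ?thesis
      unfolding prod using q by (intro mult_mono zero_le_power) auto
  qed
  also have "\<dots> \<le> (\<Prod>k\<in>K. prob {\<omega> \<in> space M. Z N k \<omega> \<in> {- a k..a k}})"
    using g_le r C by (intro prod_mono) (auto simp: g_def)
  also have "\<dots> = prob {\<omega> \<in> space M. \<forall>k\<in>K. Z N k \<omega> \<in> {- a k..a k}}"
    by (rule prob_Z_Ball[symmetric]) (auto simp: K_def N)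
  also have "\<dots> \<le> prob {\<omega> \<in> space M. \<forall>j<N. \<bar>X (real j / N) \<omega>\<bar> \<le> r}"
  proof (rule finite_measure_mono)
    show "{\<omega> \<in> space M. \<forall>j<N. \<bar>X (real j / N) \<omega>\<bar> \<le> r} \<in> events"
      by measurable
    have "2 * sum a K \<le> r"
    proof -
      have "2 * sum a K = r / C * (\<Sum>k\<in>K. exp (- e k / 8))"
        by (simp add: a_def sum_distrib_left)
      also have "\<dots> \<le> r / C * C"
        using weights[of K] r C by (intro mult_left_mono) (auto simp: K_def e_def)
      finally show ?thesis
        using C by simp
    qed
    then have "\<bar>X (real j / N) \<omega>\<bar> \<le> r" if "j < N" "\<forall>k\<in>K. Z N k \<omega> \<in> {- a k..a k}" for j \<omega>
      using abs_hartley_inversion_le[OF N that(1), of "\<lambda>t. X t \<omega>" a] that(2)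
      by (auto simp: K_def Z_def abs_le_iff minus_le_iff)
    then show "{\<omega> \<in> space M. \<forall>k\<in>K. Z N k \<omega> \<in> {- a k..a k}} \<subseteq> {\<omega> \<in> space M. \<forall>j<N. \<bar>X (real j / N) \<omega>\<bar> \<le> r}"
      by blast
  qed
  finally show ?thesis .
qed

lemma ex_prob_SUP_ge:
  obtains C where "1 \<le> C" and
    "\<And>r T b. 0 < r \<Longrightarrow> r < 1 \<Longrightarrow> T = 16 * - ln r + 8 * ln (8 * C ^ 4) \<Longrightarrow> T powr (1 / \<nu>) < real b + 1 \<Longrightarrow>
      (r / (8 * C ^ 2)) ^ (2 * b + 1) * exp (- C) \<le> prob {\<omega> \<in> space M. (SUP t\<in>{0..1}. \<bar>X t \<omega>\<bar>) \<le> r}"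
proof -
  define I where "I c = (LINT m|count_space UNIV. exp (- c * \<bar>real_of_int m\<bar> powr \<nu>))" for c
  \<comment> \<open>Chosen before \<open>r\<close> and the grid, and depending on \<nu>
    alone.\<close>
  define C where "C = max 1 (max (I (1 / 2)) (I (1 / 8)))"
  have C: "1 \<le> C" "I (1 / 2) \<le> C" "I (1 / 8) \<le> C"
    by (auto simp: C_def)
  have weights: "(\<Sum>k\<in>S. exp (- (1 / 8) * \<bar>real_of_int k\<bar> powr \<nu>)) \<le> C" if "finite S" for S
    using finite_sum_le_integral_count_space[OF integrable_exp_abs_powr_count_space[OF \<nu>_pos, of "1 / 8"] _ that] C(3)
    unfolding I_def by force
  show thesis
  proof (rule that[OF C(1)])
    fix r T :: real and b :: nat
    assume *: "0 < r" "r < 1" "T = 16 * - ln r + 8 * ln (8 * C ^ 4)" "T powr (1 / \<nu>) < real b + 1"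
    show "(r / (8 * C ^ 2)) ^ (2 * b + 1) * exp (- C) \<le> prob {\<omega> \<in> space M. (SUP t\<in>{0..1}. \<bar>X t \<omega>\<bar>) \<le> r}"
    proof (rule prob_SUP_ge_if_grid)
      fix m :: nat
      have "odd (3 ^ m :: nat)"
        by simp
      then obtain n where n: "(3 ^ m :: nat) = 2 * n + 1"
        by (rule oddE)
      show "(r / (8 * C ^ 2)) ^ (2 * b + 1) * exp (- C) \<le> prob {\<omega> \<in> space M. \<forall>j<3 ^ m. \<bar>X (real j / real (3 ^ m)) \<omega>\<bar> \<le> r}"
        by (rule prob_grid_ge[OF *(1,2) C(1) C(2)[unfolded I_def] weights *(3,4) n])
    qed
  qed
qed

section \<open>Bounds for the logarithm of the probability\<close>

lemma eventually_small_deviation_ge: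
  "\<forall>\<^sub>F r in at_right 0. 1 / 4 * \<bar>ln r\<bar> powr (1 + 1 / \<nu>) \<le> small_deviation M X r"
proof -
  obtain C where C: "1 \<le> C" and pos: "\<And>r T b. 0 < r \<Longrightarrow> r < 1 \<Longrightarrow> T = 16 * - ln r + 8 * ln (8 * C ^ 4) \<Longrightarrow> T powr (1 / \<nu>) < real b + 1 \<Longrightarrow>
      (r / (8 * C ^ 2)) ^ (2 * b + 1) * exp (- C) \<le> prob {\<omega> \<in> space M. (SUP t\<in>{0..1}. \<bar>X t \<omega>\<bar>) \<le> r}"
    using ex_prob_SUP_ge by blast
  have "\<forall>\<^sub>F r in at_right (0::real). 0 < r \<and> r < exp (- (4 * ln 2))"
    by (auto simp: eventually_at_right_field intro!: exI[of _ "exp (- (4 * ln 2))"])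
  then show ?thesis
  proof eventually_elim
    case (elim r)
    define L where "L = - ln r"
    have "ln r < ln (exp (- (4 * ln 2)))"
      using elim by (subst ln_less_cancel_iff) auto
    \<comment> \<open>Together with \<open>real n powr \<nu> \<le> L\<close> this bounds
      \<open>ln 2 - L + real n powr \<nu> / 2\<close> by \<open>- (L / 4)\<close>.\<close>
    then have L: "4 * ln 2 < L"
      by (simp add: L_def)
    then have L0: "0 < L"
      using ln_gt_zero[of "2::real"] by linarith
    then have r1: "r < 1"
      using elim by (simp add: L_def)
    define n where "n = nat \<lfloor>L powr (1 / \<nu>)\<rfloor>"
    have n: "real n \<le> L powr (1 / \<nu>)" "L powr (1 / \<nu>) \<le> real (Suc n)"
      using powr_ge_zero[of L "1 / \<nu>"] unfolding n_def by linarith+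
    let ?P = "prob {\<omega> \<in> space M. (SUP t\<in>{0..1}. \<bar>X t \<omega>\<bar>) \<le> r}"
    \<comment> \<open>Since \<open>ln 0 = 0\<close>, an upper bound for the probability yields one
      for its logarithm only once the probability is positive; the opposite estimate supplies
      this.\<close>
    have "0 < ?P"
    proof -
      let ?T = "16 * - ln r + 8 * ln (8 * C ^ 4)"
      have "0 < (r / (8 * C ^ 2)) ^ (2 * nat \<lfloor>?T powr (1 / \<nu>)\<rfloor> + 1) * exp (- C)"
        using elim C by simp
      also have "\<dots> \<le> ?P"
      proof (rule pos[OF _ r1 refl])
        show "?T powr (1 / \<nu>) < real (nat \<lfloor>?T powr (1 / \<nu>)\<rfloor>) + 1"
          using powr_ge_zero[of ?T "1 / \<nu>"] by linarith
      qed (use elim in simp)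
      finally show ?thesis .
    qed
    have "real n powr \<nu> \<le> (L powr (1 / \<nu>)) powr \<nu>"
      using n \<nu>_pos by (intro powr_mono2) auto
    also have "\<dots> = L"
      using \<nu>_pos L0 by (simp add: powr_powr)
    finally have nL: "real n powr \<nu> \<le> L" .
    have "?P \<le> (2 * r * exp (real n powr \<nu> / 2)) ^ Suc n"
      using elim by (intro prob_SUP_le) simp
    then have "ln ?P \<le> ln ((2 * r * exp (real n powr \<nu> / 2)) ^ Suc n)"
      using \<open>0 < ?P\<close> by (subst ln_le_cancel_iff) auto
    also have "\<dots> = real (Suc n) * (ln 2 - L + real n powr \<nu> / 2)"
      using elim by (subst ln_realpow) (auto simp: ln_mult L_def)
    also have "\<dots> \<le> real (Suc n) * (- (L / 4))"
      using nL L by (intro mult_left_mono) auto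
    finally have "real (Suc n) * (L / 4) \<le> small_deviation M X r"
      by (simp add: small_deviation_def)
    moreover have "L powr (1 / \<nu>) * (L / 4) \<le> real (Suc n) * (L / 4)"
      using n L0 by (intro mult_right_mono) auto
    moreover have "1 / 4 * \<bar>ln r\<bar> powr (1 + 1 / \<nu>) = L powr (1 / \<nu>) * (L / 4)"
      using L0 by (simp add: L_def powr_add)
    ultimately show ?case
      by linarith
  qed
qed

lemma eventually_small_deviation_le:
  "\<exists>K. \<forall>\<^sub>F r in at_right 0. small_deviation M X r \<le> K * \<bar>ln r\<bar> powr (1 + 1 / \<nu>)"
proof -
  obtain C where C: "1 \<le> C" and pos: "\<And>r T b. 0 < r \<Longrightarrow> r < 1 \<Longrightarrow> T = 16 * - ln r + 8 * ln (8 * C ^ 4) \<Longrightarrow> T powr (1 / \<nu>) < real b + 1 \<Longrightarrow>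
      (r / (8 * C ^ 2)) ^ (2 * b + 1) * exp (- C) \<le> prob {\<omega> \<in> space M. (SUP t\<in>{0..1}. \<bar>X t \<omega>\<bar>) \<le> r}"
    using ex_prob_SUP_ge by blast
  \<comment> \<open>For \<open>L > B\<close> all constants are absorbed by \<open>L\<close>; in
    particular \<open>T\<close> is at most \<open>(16 + 1) * L\<close>, the origin of the 17 in the
    final constant.\<close>
  define B where "B = max (max 1 C) (max (8 * ln (8 * C ^ 4)) (ln (8 * C ^ 2)))"
  have "\<forall>\<^sub>F r in at_right (0::real). 0 < r \<and> r < exp (- B)"
    by (auto simp: eventually_at_right_field intro!: exI[of _ "exp (- B)"])
  then have "\<forall>\<^sub>F r in at_right 0. small_deviation M X r \<le> (3 + 4 * 17 powr (1 / \<nu>)) * \<bar>ln r\<bar> powr (1 + 1 / \<nu>)"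
  proof eventually_elim
    case (elim r)
    define L where "L = - ln r"
    have "ln r < ln (exp (- B))"
      using elim by (subst ln_less_cancel_iff) auto
    then have "B < L"
      by (simp add: L_def)
    then have L: "1 \<le> L" "C \<le> L" "8 * ln (8 * C ^ 4) \<le> L" "ln (8 * C ^ 2) \<le> L"
      by (auto simp: B_def)
    then have "ln r < 0"
      by (simp add: L_def)
    then have r1: "r < 1"
      using elim by simp
    define T where "T = 16 * L + 8 * ln (8 * C ^ 4)"
    define b where "b = nat \<lfloor>T powr (1 / \<nu>)\<rfloor>"
    have b: "real b \<le> T powr (1 / \<nu>)" "T powr (1 / \<nu>) < real b + 1"
      using powr_ge_zero[of T "1 / \<nu>"] unfolding b_def by linarith+
    let ?P = "prob {\<omega> \<in> space M. (SUP t\<in>{0..1}. \<bar>X t \<omega>\<bar>) \<le> r}"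
    let ?Q = "(r / (8 * C ^ 2)) ^ (2 * b + 1) * exp (- C)"
    have "0 < ?Q"
      using elim C by simp
    moreover have "?Q \<le> ?P"
      by (rule pos[OF _ r1 _ b(2)]) (use elim in \<open>simp_all add: T_def L_def\<close>)
    ultimately have Q: "0 < ?Q" "?Q \<le> ?P" .
    have "ln ?Q = real (2 * b + 1) * ln (r / (8 * C ^ 2)) - C"
      using elim C by (simp add: ln_mult_pos ln_realpow del: power_Suc)
    also have "ln (r / (8 * C ^ 2)) = - L - ln (8 * C ^ 2)"
      using elim C by (subst ln_div) (auto simp: L_def)
    finally have "ln ?Q = real (2 * b + 1) * (- L - ln (8 * C ^ 2)) - C" .
    moreover have "ln ?Q \<le> ln ?P"
      using Q by (subst ln_le_cancel_iff) auto
    ultimately have "small_deviation M X r \<le> real (2 * b + 1) * (L + ln (8 * C ^ 2)) + C"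
      by (simp add: small_deviation_def algebra_simps)
    also have "\<dots> \<le> real (2 * b + 1) * (2 * L) + L"
      using L by (intro add_mono mult_left_mono) auto
    also have "\<dots> = 3 * L + 4 * real b * L"
      by (simp add: algebra_simps)
    also have "\<dots> \<le> 3 * L powr (1 + 1 / \<nu>) + 4 * 17 powr (1 / \<nu>) * L powr (1 + 1 / \<nu>)"
    proof (rule add_mono)
      have "L powr 1 \<le> L powr (1 + 1 / \<nu>)"
        using L \<nu>_pos by (intro powr_mono) auto
      then show "3 * L \<le> 3 * L powr (1 + 1 / \<nu>)"
        using L by simp
      \<comment> \<open>Makes \<open>T\<close> nonnegative, as monotonicity of \<open>powr\<close>
        in its base requires.\<close>
      have "0 \<le> ln (8 * C ^ 4)"
        using C one_le_power[of C 4] by (intro ln_ge_zero) linarith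
      then have "T powr (1 / \<nu>) \<le> (17 * L) powr (1 / \<nu>)"
        using L \<nu>_pos by (intro powr_mono2) (auto simp: T_def)
      with b(1) have "real b \<le> 17 powr (1 / \<nu>) * L powr (1 / \<nu>)"
        using L by (simp add: powr_mult)
      then have "real b * L \<le> 17 powr (1 / \<nu>) * L powr (1 / \<nu>) * L"
        using L by (intro mult_right_mono) auto
      then show "4 * real b * L \<le> 4 * 17 powr (1 / \<nu>) * L powr (1 + 1 / \<nu>)"
        using L by (simp add: powr_add mult_ac)
    qed
    also have "\<dots> = (3 + 4 * 17 powr (1 / \<nu>)) * L powr (1 + 1 / \<nu>)"
      by (simp add: algebra_simps)
    also have "L = \<bar>ln r\<bar>"
      using L by (simp add: L_def)
    finally show ?case .
  qed
  then show ?thesis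
    by blast
qed

end

lemma asymp_leI:
  assumes "\<forall>\<^sub>F r in at_right 0. 0 < f r" "\<forall>\<^sub>F r in at_right 0. 0 < g r" "\<forall>\<^sub>F r in at_right 0. f r \<le> K * g r"
  shows "f \<preceq>\<^sub>0 g"
proof -
  have "\<forall>\<^sub>F r in at_right 0. ereal (f r / g r) \<le> ereal K"
    using assms(2,3) by eventually_elim (simp add: divide_le_eq)
  then have "Limsup (at_right 0) (\<lambda>r. ereal (f r / g r)) \<le> ereal K"
    by (rule Limsup_bounded)
  then show ?thesis
    unfolding asymp_le_def using assms(1,2) by (auto intro: le_less_trans)
qed

theorem theorem1p2:
  fixes \<nu> :: real and M :: "'a measure" and X :: "real \<Rightarrow> 'a \<Rightarrow> real"
  assumes "\<nu> > 0"
    and "prob_space M"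
    and "gaussian_process M X"
    and "centered_process M X"
    and "stationary_process M X"
    and "continuous_paths M X"
    and "has_spectral_measure M X (discrete_spectral_measure \<nu>)"
  shows "small_deviation M X \<approx>\<^sub>0 (\<lambda>r. \<bar>ln r\<bar> powr (1 + 1 / \<nu>))"
proof -
  interpret discrete_spectral_process M X \<nu>
    using assms by (auto simp: discrete_spectral_process_def discrete_spectral_process_axioms_def)
  have "\<forall>\<^sub>F r in at_right (0::real). 0 < r \<and> r < 1"
    by (auto simp: eventually_at_right_field intro!: exI[of _ 1])
  then have g: "\<forall>\<^sub>F r in at_right 0. 0 < \<bar>ln r\<bar> powr (1 + 1 / \<nu>)"
    by eventually_elim simp
  have f: "\<forall>\<^sub>F r in at_right 0. 0 < small_deviation M X r"
    using g eventually_small_deviation_ge by eventually_elim linarith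
  obtain K where "\<forall>\<^sub>F r in at_right 0. small_deviation M X r \<le> K * \<bar>ln r\<bar> powr (1 + 1 / \<nu>)"
    using eventually_small_deviation_le by blast
  moreover have "\<forall>\<^sub>F r in at_right 0. \<bar>ln r\<bar> powr (1 + 1 / \<nu>) \<le> 4 * small_deviation M X r"
    using eventually_small_deviation_ge by eventually_elim linarith
  ultimately show ?thesis
    unfolding asymp_eq_def using f g by (blast intro: asymp_leI)
qed

end
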